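(* Let $F$ be a singular fiber of Kodaira type $III^*$ of an elliptic fibration on a smooth $K3$ surface, written $$F=4C+2S_1+3M_1+2M_2+M_3+3L_1+2L_2+L_3.$$ Let $R$ be an ADER in $F$ with $C\subset\operatorname{Supp}(R)$. Let $\Gamma$ be the connected component of $R$ containing $C$, and write $$\Gamma=C+S_1+\cdots+S_\alpha+M_1+\cdots+M_\beta+L_1+\cdots+L_\gamma$$ with $\alpha\in\{0,1\}$ and $\beta,\gamma\in\{0,1,2,3\}$ (terms being omitted when the corresponding integer is $0$), and $R=\Gamma+R_M^{\mathrm{tail}}+R_L^{\mathrm{tail}}$, where $R_M^{\mathrm{tail}}$ and $R_L^{\mathrm{tail}}$ are the remaining parts of $R$ supported on the $M$- and $L$-branches. Then $(\alpha,\beta,\gamma)$ satisfies one of the following conditions. (1) At most two of $\alpha,\beta,\gamma$ are nonzero. In this case $\Gamma$ is of type $A_{1+\alpha+\beta+\gamma}$. (2) The three integers $\alpha,\beta,\gamma$ are all nonzero. By the symmetry interchanging the $M$- and $L$-branches, assume, when listing the possibilities, that $\beta\leq\gamma$ (the remaining cases being obtained by interchanging the $M$- and $L$-branches). Under this convention $(\beta,\gamma)\neq(3,3)$, and the type of $\Gamma$ is as follows: (a) if $\beta=1$, then $\Gamma$ is of type $D_{\gamma+3}$; (b) if $(\beta,\gamma)=(2,2)$, then $\Gamma$ is of type $E_6$; (c) if $(\beta,\gamma)=(2,3)$, then $\Gamma$ is of type $E_7$. Moreover, $R_M^{\mathrm{tail}}$ is either zero or a disjoint union of mutually disjoint consecutive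 subchains of $M_{\beta+2}-\cdots-M_3$, where this chain means $M_2-M_3$ if $\beta=0$, $M_3$ if $\beta=1$, and the empty chain if $\beta\geq2$. If $R_M^{\mathrm{tail}}\neq0$, then it is of type $A_{\mu_1}\oplus\cdots\oplus A_{\mu_a}$ for some $\mu_1,\dots,\mu_a\geq1$ satisfying $$\sum_{i=1}^a\mu_i+a-1\leq2-\beta.$$ The same assertion holds for $R_L^{\mathrm{tail}}$, with $M,\beta,\mu_i,a$ replaced by $L,\gamma,\lambda_j,b$, respectively. Conversely, consider a reduced subdivisor of $F$ of the form $\Gamma+R_M^{\mathrm{tail}}+R_L^{\mathrm{tail}}$, where $\Gamma=C+S_1+\cdots+S_\alpha+M_1+\cdots+M_\beta+L_1+\cdots+L_\gamma$ with $\alpha\in\{0,1\}$, $\beta,\gamma\in\{0,1,2,3\}$, and either at most two of $\alpha,\beta,\gamma$ are nonzero, or all three are nonzero with $\beta\leq\gamma$ and $(\beta,\gamma)\neq(3,3)$; $R_M^{\mathrm{tail}}$ is zero or a disjoint union of mutually disjoint consecutive subchains of $M_{\beta+2}-\cdots-M_3$, of type $A_{\mu_1}\oplus\cdots\oplus A_{\mu_a}$ with $\sum_{i=1}^a\mu_i+a-1\leq2-\beta$ if nonzero; and $R_L^{\mathrm{tail}}$ is zero or a disjoint union of mutually disjoint consecutive subchains of $L_{\gamma+2}-\cdots-L_3$ (with the same convention), of type $A_{\lambda_1}\oplus\cdots\oplus A_{\lambda_b}$ with $\sum_{j=1}^b\lambda_j+b-1\leq2-\gamma$ if nonzero. Every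 such subdivisor, or one obtained from such a subdivisor by interchanging the $M$- and $L$-branches, is an ADER.
   Context: We work over an algebraically closed field of characteristic $0$. In a fiber of type $III^*$ all components are smooth rational $(-2)$-curves, meeting transversely in at most one point, with dual graph $\widetilde E_7$: the central vertex $C$ is the unique component meeting three others, and three branches start at $C$: $C-S_1$, $C-M_1-M_2-M_3$, and $C-L_1-L_2-L_3$. Since $\Gamma$ is connected and contains $C$, it meets each branch in an initial segment, so $\alpha,\beta,\gamma$ are well defined. An ADE reduced divisor (ADER) in $F$ is a reduced subdivisor of $F$ (a sum of distinct components) whose dual graph is a disjoint union of Dynkin diagrams of type $A_k$, $D_l$ ($l\ge4$), $E_6,E_7,E_8$; its type is the type of this graph, with $\oplus$ denoting disjoint union. Mutually disjoint consecutive subchains are pairwise separated by at least one unused vertex. *)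

theory Defs
  imports
    "HOL-Analysis.Analysis"
    "HOL-Combinatorics.Transposition"
    "HOL-Computational_Algebra.Polynomial"
    "HOL-Library.Multiset"
begin

section \<open>Projective varieties over a field\<close>

text \<open>
  The library has no schemes, so varieties are treated classically: over an algebraically closed
  field a projective variety is its set of closed points, with the Zariski topology and the sheaf of
  regular functions.  A point of projective space is the set of all its homogeneous coordinate
  vectors.  Coordinate vectors have type \<^typ>\<open>nat \<Rightarrow> 'k\<close>; in \<open>n\<close>-dimensional projective space the
  coordinates beyond index \<open>n\<close> vanish.  The projective spaces are thus nested linear subspaces, which
  does not affect the induced topology or the regular functions.
\<close>

type_synonym 'k ppoint = "(nat \<Rightarrow> 'k) set"

definition projective_space :: "nat \<Rightarrow> 'k::field ppoint set" where
  "projective_space n =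
     {{(\<lambda>i. c * v i) | c. c \<noteq> 0} | v. v \<noteq> (\<lambda>_. 0) \<and> (\<forall>i>n. v i = 0)}"

inductive is_form :: "nat \<Rightarrow> ((nat \<Rightarrow> 'k::field) \<Rightarrow> 'k) \<Rightarrow> bool" where
  form_const: "is_form 0 (\<lambda>_. c)"
| form_coord: "is_form 1 (\<lambda>x. x i)"
| form_add: "is_form d f \<Longrightarrow> is_form d g \<Longrightarrow> is_form d (\<lambda>x. f x + g x)"
| form_mult: "is_form d f \<Longrightarrow> is_form e g \<Longrightarrow> is_form (d + e) (\<lambda>x. f x * g x)"

definition zariski :: "'k::field ppoint set \<Rightarrow> 'k ppoint topology" where
  "zariski X = subtopology
     (topology_generated_by
       {{p \<in> (\<Union>n. projective_space n). \<forall>v\<in>p. f v \<noteq> 0} | f. \<exists>d. is_form d f}) X"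

definition irreducible_space :: "'a topology \<Rightarrow> bool" where
  "irreducible_space T \<longleftrightarrow> topspace T \<noteq> {} \<and>
     (\<forall>A B. closedin T A \<and> closedin T B \<and> A \<union> B = topspace T
        \<longrightarrow> A = topspace T \<or> B = topspace T)"

definition irreducible_chain :: "'a topology \<Rightarrow> nat \<Rightarrow> (nat \<Rightarrow> 'a set) \<Rightarrow> bool" where
  "irreducible_chain T d Z \<longleftrightarrow>
     (\<forall>i\<le>d. closedin T (Z i) \<and> irreducible_space (subtopology T (Z i))) \<and>
     (\<forall>i<d. Z i \<subset> Z (Suc i))"

definition has_krull_dimension :: "'a topology \<Rightarrow> nat \<Rightarrow> bool" where
  "has_krull_dimension T d \<longleftrightarrow>
     (\<exists>Z. irreducible_chain T d Z) \<and> (\<forall>e Z. irreducible_chain T e Z \<longrightarrow> e \<le> d)"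

definition projective_variety :: "nat \<Rightarrow> 'k::field ppoint set \<Rightarrow> bool" where
  "projective_variety d X \<longleftrightarrow>
     (\<exists>n. X \<subseteq> projective_space n \<and> closedin (zariski (projective_space n)) X) \<and>
     irreducible_space (zariski X) \<and> has_krull_dimension (zariski X) d"

text \<open>Only the values of \<open>\<phi>\<close> on \<open>U\<close> are relevant here.\<close>

definition regular_on :: "'k::field ppoint set \<Rightarrow> 'k ppoint set \<Rightarrow> ('k ppoint \<Rightarrow> 'k) \<Rightarrow> bool" where
  "regular_on X U \<phi> \<longleftrightarrow> openin (zariski X) U \<and>
     (\<forall>p\<in>U. \<exists>V d g h. openin (zariski X) V \<and> p \<in> V \<and> V \<subseteq> U \<and> is_form d g \<and> is_form d h \<and>
        (\<forall>q\<in>V. \<forall>v\<in>q. h v \<noteq> 0 \<and> \<phi> q = g v / h v))"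

definition regular_at :: "'k::field ppoint set \<Rightarrow> 'k ppoint \<Rightarrow> ('k ppoint \<Rightarrow> 'k) \<Rightarrow> bool" where
  "regular_at X p \<phi> \<longleftrightarrow> (\<exists>U. p \<in> U \<and> regular_on X U \<phi>)"

definition morphism ::
  "'k::field ppoint set \<Rightarrow> 'k ppoint set \<Rightarrow> ('k ppoint \<Rightarrow> 'k ppoint) \<Rightarrow> bool" where
  "morphism X Y f \<longleftrightarrow> continuous_map (zariski X) (zariski Y) f \<and>
     (\<forall>V \<phi>. regular_on Y V \<phi> \<longrightarrow> regular_on X {p\<in>X. f p \<in> V} (\<phi> \<circ> f))"

definition isomorphic_varieties :: "'k::field ppoint set \<Rightarrow> 'k ppoint set \<Rightarrow> bool" where
  "isomorphic_varieties X Y \<longleftrightarrow>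
     (\<exists>f g. morphism X Y f \<and> morphism Y X g \<and> (\<forall>p\<in>X. g (f p) = p) \<and> (\<forall>q\<in>Y. f (g q) = q))"

text \<open>The members of \<open>ts\<close> generate the maximal ideal of the local ring at \<open>p\<close>.\<close>

definition generate_max_ideal ::
  "'k::field ppoint set \<Rightarrow> 'k ppoint \<Rightarrow> ('k ppoint \<Rightarrow> 'k) list \<Rightarrow> bool" where
  "generate_max_ideal X p ts \<longleftrightarrow>
     (\<forall>t\<in>set ts. regular_at X p t \<and> t p = 0) \<and>
     (\<forall>\<phi>. regular_at X p \<phi> \<and> \<phi> p = 0 \<longrightarrow>
        (\<exists>as. length as = length ts \<and> (\<forall>a\<in>set as. regular_at X p a) \<and>
           (\<forall>\<^sub>F q in nhdsin (zariski X) p. \<phi> q = (\<Sum>(a, t)\<leftarrow>zip as ts. a q * t q))))"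

text \<open>
  Smoothness as regularity of all local rings, which is the same thing over an algebraically closed
  field.
\<close>

definition smooth_projective_variety :: "nat \<Rightarrow> 'k::field ppoint set \<Rightarrow> bool" where
  "smooth_projective_variety d X \<longleftrightarrow> projective_variety d X \<and>
     (\<forall>p\<in>X. \<exists>ts. length ts = d \<and> generate_max_ideal X p ts)"


section \<open>Differential forms, K3 surfaces and elliptic fibrations\<close>

text \<open>
  Tangent vectors at \<open>p\<close> are the derivations of the local ring at \<open>p\<close> into the field; a germ is
  represented by any function agreeing with it near \<open>p\<close>.  On a smooth variety a regular differential
  form is determined by its values on tangent vectors at closed points.
\<close>

definition derivation_at ::
  "'k::field ppoint set \<Rightarrow> 'k ppoint \<Rightarrow> (('k ppoint \<Rightarrow> 'k) \<Rightarrow> 'k) \<Rightarrow> bool" where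
  "derivation_at X p D \<longleftrightarrow>
     (\<forall>c. D (\<lambda>_. c) = 0) \<and>
     (\<forall>\<phi> \<psi>. regular_at X p \<phi> \<and> regular_at X p \<psi> \<longrightarrow>
        D (\<lambda>q. \<phi> q + \<psi> q) = D \<phi> + D \<psi> \<and>
        D (\<lambda>q. \<phi> q * \<psi> q) = \<phi> p * D \<psi> + \<psi> p * D \<phi> \<and>
        ((\<forall>\<^sub>F q in nhdsin (zariski X) p. \<phi> q = \<psi> q) \<longrightarrow> D \<phi> = D \<psi>))"

definition regular_1form ::
  "'k::field ppoint set \<Rightarrow> ('k ppoint \<Rightarrow> (('k ppoint \<Rightarrow> 'k) \<Rightarrow> 'k) \<Rightarrow> 'k) \<Rightarrow> bool" where
  "regular_1form X \<omega> \<longleftrightarrow>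
     (\<forall>p\<in>X. \<exists>U gfs. p \<in> U \<and> (\<forall>(g, f)\<in>set gfs. regular_on X U g \<and> regular_on X U f) \<and>
        openin (zariski X) U \<and>
        (\<forall>q\<in>U. \<forall>D. derivation_at X q D \<longrightarrow> \<omega> q D = (\<Sum>(g, f)\<leftarrow>gfs. g q * D f)))"

text \<open>Locally a finite sum of terms \<open>g df \<and> dh\<close>.\<close>

definition regular_2form ::
  "'k::field ppoint set \<Rightarrow>
   ('k ppoint \<Rightarrow> (('k ppoint \<Rightarrow> 'k) \<Rightarrow> 'k) \<Rightarrow> (('k ppoint \<Rightarrow> 'k) \<Rightarrow> 'k) \<Rightarrow> 'k) \<Rightarrow> bool" where
  "regular_2form X \<omega> \<longleftrightarrow>
     (\<forall>p\<in>X. \<exists>U gfhs. p \<in> U \<and> openin (zariski X) U \<and>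
        (\<forall>(g, f, h)\<in>set gfhs. regular_on X U g \<and> regular_on X U f \<and> regular_on X U h) \<and>
        (\<forall>q\<in>U. \<forall>D D'. derivation_at X q D \<and> derivation_at X q D' \<longrightarrow>
           \<omega> q D D' = (\<Sum>(g, f, h)\<leftarrow>gfhs. g q * (D f * D' h - D' f * D h))))"

text \<open>A nowhere vanishing section of the canonical bundle of a smooth surface.\<close>

definition trivial_canonical_bundle :: "'k::field ppoint set \<Rightarrow> bool" where
  "trivial_canonical_bundle X \<longleftrightarrow>
     (\<exists>\<omega>. regular_2form X \<omega> \<and>
        (\<forall>p\<in>X. \<exists>D D'. derivation_at X p D \<and> derivation_at X p D' \<and> \<omega> p D D' \<noteq> 0))"

text \<open>
  The first cohomology of the structure sheaf, as the limit of Cech cohomology over all open covers.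
  As the first Cech group of each cover injects into the limit, the limit vanishes iff every
  1-cocycle on every cover is a coboundary on that cover.
\<close>

definition structure_sheaf_H1_zero :: "'k::field ppoint set \<Rightarrow> bool" where
  "structure_sheaf_H1_zero X \<longleftrightarrow>
     (\<forall>\<U> g. (\<forall>U\<in>\<U>. openin (zariski X) U) \<and> \<Union>\<U> = X \<and>
        (\<forall>U\<in>\<U>. \<forall>V\<in>\<U>. regular_on X (U \<inter> V) (g U V)) \<and>
        (\<forall>U\<in>\<U>. \<forall>V\<in>\<U>. \<forall>W\<in>\<U>. \<forall>p\<in>U \<inter> V \<inter> W. g U W p = g U V p + g V W p)
        \<longrightarrow> (\<exists>h. (\<forall>U\<in>\<U>. regular_on X U (h U)) \<and>
               (\<forall>U\<in>\<U>. \<forall>V\<in>\<U>. \<forall>p\<in>U \<inter> V. g U V p = h V p - h U p)))"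

definition K3_surface :: "'k::field ppoint set \<Rightarrow> bool" where
  "K3_surface X \<longleftrightarrow> smooth_projective_variety 2 X \<and>
     trivial_canonical_bundle X \<and> structure_sheaf_H1_zero X"

text \<open>The space of regular 1-forms is one-dimensional.\<close>

definition smooth_genus_one_curve :: "'k::field ppoint set \<Rightarrow> bool" where
  "smooth_genus_one_curve E \<longleftrightarrow> smooth_projective_variety 1 E \<and>
     (\<exists>\<omega>\<^sub>0. regular_1form E \<omega>\<^sub>0 \<and> (\<exists>p\<in>E. \<exists>D. derivation_at E p D \<and> \<omega>\<^sub>0 p D \<noteq> 0) \<and>
        (\<forall>\<omega>. regular_1form E \<omega> \<longrightarrow>
           (\<exists>c. \<forall>p\<in>E. \<forall>D. derivation_at E p D \<longrightarrow> \<omega> p D = c * \<omega>\<^sub>0 p D)))"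

text \<open>
  In characteristic 0 almost all scheme-theoretic fibers are reduced, so that it suffices to look at
  fibers as sets of points.  A section is not required.
\<close>

definition elliptic_fibration ::
  "'k::field ppoint set \<Rightarrow> 'k ppoint set \<Rightarrow> ('k ppoint \<Rightarrow> 'k ppoint) \<Rightarrow> bool" where
  "elliptic_fibration X B \<pi> \<longleftrightarrow>
     smooth_projective_variety 2 X \<and> smooth_projective_variety 1 B \<and>
     morphism X B \<pi> \<and> \<pi> ` X = B \<and>
     finite {b\<in>B. \<not> smooth_genus_one_curve {p\<in>X. \<pi> p = b}}"


section \<open>Divisors\<close>

text \<open>
  An effective divisor on a surface is a finite multiset of irreducible curves; subdivisors are
  submultisets and the support is the underlying set.
\<close>

text \<open>The ideal of \<open>E\<close> in the local ring of \<open>X\<close> at \<open>p\<close> is generated by \<open>e\<close>.\<close>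

definition local_equation ::
  "'k::field ppoint set \<Rightarrow> 'k ppoint set \<Rightarrow> 'k ppoint \<Rightarrow> ('k ppoint \<Rightarrow> 'k) \<Rightarrow> bool" where
  "local_equation X E p e \<longleftrightarrow> regular_at X p e \<and>
     (\<forall>\<phi>. regular_at X p \<phi> \<longrightarrow>
        ((\<forall>\<^sub>F q in nhdsin (zariski X) p. q \<in> E \<longrightarrow> \<phi> q = 0) \<longleftrightarrow>
         (\<exists>a. regular_at X p a \<and> (\<forall>\<^sub>F q in nhdsin (zariski X) p. \<phi> q = a q * e q))))"

text \<open>
  The order of vanishing of \<open>\<phi>\<close> along the irreducible curve \<open>E\<close> is \<open>n\<close>: near some point of \<open>E\<close>,
  \<open>\<phi> = u e ^ n\<close> with \<open>u\<close> not identically zero on \<open>E\<close>, hence a unit in the local ring of \<open>X\<close> along \<open>E\<close>.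
\<close>

definition vanishing_order ::
  "'k::field ppoint set \<Rightarrow> 'k ppoint set \<Rightarrow> ('k ppoint \<Rightarrow> 'k) \<Rightarrow> nat \<Rightarrow> bool" where
  "vanishing_order X E \<phi> n \<longleftrightarrow>
     (\<exists>p\<in>E. \<exists>e u. local_equation X E p e \<and> regular_at X p u \<and>
        \<not> (\<forall>\<^sub>F q in nhdsin (zariski X) p. q \<in> E \<longrightarrow> u q = 0) \<and>
        (\<forall>\<^sub>F q in nhdsin (zariski X) p. \<phi> q = u q * e q ^ n))"

text \<open>
  \<open>F\<close> is the pullback of the point \<open>b\<close>: the multiplicity of a curve in the fiber is the vanishing
  order along it of a local parameter at \<open>b\<close>.
\<close>

definition is_fiber ::
  "'k::field ppoint set \<Rightarrow> 'k ppoint set \<Rightarrow> ('k ppoint \<Rightarrow> 'k ppoint) \<Rightarrow> 'k ppoint \<Rightarrow>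
   'k ppoint set multiset \<Rightarrow> bool" where
  "is_fiber X B \<pi> b F \<longleftrightarrow> b \<in> B \<and>
     (\<forall>E\<in>#F. projective_variety 1 E \<and> E \<subseteq> {p\<in>X. \<pi> p = b}) \<and>
     (\<forall>E. projective_variety 1 E \<and> E \<subseteq> {p\<in>X. \<pi> p = b} \<longrightarrow>
        (\<exists>t. generate_max_ideal B b [t] \<and> vanishing_order X E (t \<circ> \<pi>) (count F E)))"

definition meet_transversely ::
  "'k::field ppoint set \<Rightarrow> 'k ppoint set \<Rightarrow> 'k ppoint set \<Rightarrow> bool" where
  "meet_transversely X E E' \<longleftrightarrow>
     (\<forall>p\<in>E \<inter> E'. \<exists>e e'. local_equation X E p e \<and> local_equation X E' p e' \<and>
        generate_max_ideal X p [e, e'])"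

definition reduced_divisor :: "'c multiset \<Rightarrow> bool" where
  "reduced_divisor R \<longleftrightarrow> (\<forall>E. count R E \<le> 1)"


section \<open>Dual graphs and Dynkin diagrams\<close>

text \<open>A simple graph is a set of vertices with a set of two-element sets of vertices as edges.\<close>

type_synonym 'v graph = "'v set \<times> 'v set set"

definition graph_isomorphic :: "'v graph \<Rightarrow> 'w graph \<Rightarrow> bool" where
  "graph_isomorphic G H \<longleftrightarrow>
     (\<exists>f. bij_betw f (fst G) (fst H) \<and>
        (\<forall>x\<in>fst G. \<forall>y\<in>fst G. {x, y} \<in> snd G \<longleftrightarrow> {f x, f y} \<in> snd H))"

text \<open>
  Edge multiplicities are not recorded: the definition is only applied to components of a fiber in
  which distinct components meet transversely in at most one point.
\<close>

definition dual_graph :: "'p set multiset \<Rightarrow> 'p set graph" where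
  "dual_graph R =
     (set_mset R, {{E, E'} | E E'. E \<in># R \<and> E' \<in># R \<and> E \<noteq> E' \<and> E \<inter> E' \<noteq> {}})"

text \<open>The connected component of \<open>R\<close> containing the curve \<open>E\<close>.\<close>

definition connected_component_of_divisor :: "'p set multiset \<Rightarrow> 'p set \<Rightarrow> 'p set multiset" where
  "connected_component_of_divisor R E =
     {#E' \<in># R. (E, E') \<in> {(u, v). {u, v} \<in> snd (dual_graph R)}\<^sup>*#}"

datatype dynkin = DynA nat | DynD nat | DynE nat

fun dynkin_type :: "dynkin \<Rightarrow> bool" where
  "dynkin_type (DynA k) \<longleftrightarrow> 1 \<le> k"
| "dynkin_type (DynD l) \<longleftrightarrow> 4 \<le> l"
| "dynkin_type (DynE n) \<longleftrightarrow> n \<in> {6, 7, 8}"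

text \<open>
  The vertices are numbered from 1.  Types D and E are a chain on all vertices but the last; the last
  vertex is joined to the penultimate vertex of the chain for D and to the third one for E.
\<close>

fun dynkin_diagram :: "dynkin \<Rightarrow> nat graph" where
  "dynkin_diagram (DynA k) = ({1..k}, {{i, i + 1} | i. 1 \<le> i \<and> i + 1 \<le> k})"
| "dynkin_diagram (DynD l) = ({1..l}, {{i, i + 1} | i. 1 \<le> i \<and> i + 1 < l} \<union> {{l - 2, l}})"
| "dynkin_diagram (DynE n) = ({1..n}, {{i, i + 1} | i. 1 \<le> i \<and> i + 1 < n} \<union> {{3, n}})"

definition disjoint_union_graph :: "'v graph list \<Rightarrow> (nat \<times> 'v) graph" where
  "disjoint_union_graph Gs =
     (SIGMA i:{..<length Gs}. fst (Gs ! i),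
      {{(i, x), (i, y)} | i x y. i < length Gs \<and> {x, y} \<in> snd (Gs ! i)})"

text \<open>
  The type of a disjoint union of Dynkin diagrams is the multiset of the types of its parts: a sum of
  types is a multiset sum, and \<^term>\<open>{#}\<close> is the type of the empty graph.
\<close>

definition has_type :: "'p set multiset \<Rightarrow> dynkin multiset \<Rightarrow> bool" where
  "has_type R T \<longleftrightarrow>
     (\<exists>ts. mset ts = T \<and> (\<forall>t\<in>set ts. dynkin_type t) \<and>
        graph_isomorphic (dual_graph R) (disjoint_union_graph (map dynkin_diagram ts)))"

definition ADER :: "'p set multiset \<Rightarrow> 'p set multiset \<Rightarrow> bool" where
  "ADER F R \<longleftrightarrow> R \<subseteq># F \<and> reduced_divisor R \<and> (\<exists>T. has_type R T)"


section \<open>Fibers of type \<open>III\<^sup>*\<close> and their subdivisors\<close>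

text \<open>
  The branches are indexed from 1, values of \<open>S\<close>, \<open>M\<close>, \<open>L\<close> at other indices being irrelevant.  The
  self-intersection number \<open>-2\<close> of the components follows from the other conditions.
\<close>

definition type_III_star ::
  "'k::field ppoint set \<Rightarrow> 'k ppoint set multiset \<Rightarrow> 'k ppoint set \<Rightarrow> (nat \<Rightarrow> 'k ppoint set) \<Rightarrow>
   (nat \<Rightarrow> 'k ppoint set) \<Rightarrow> (nat \<Rightarrow> 'k ppoint set) \<Rightarrow> bool" where
  "type_III_star X F C S M L \<longleftrightarrow>
     distinct [C, S 1, M 1, M 2, M 3, L 1, L 2, L 3] \<and>
     F = replicate_mset 4 C + replicate_mset 2 (S 1) +
         replicate_mset 3 (M 1) + replicate_mset 2 (M 2) + replicate_mset 1 (M 3) +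
         replicate_mset 3 (L 1) + replicate_mset 2 (L 2) + replicate_mset 1 (L 3) \<and>
     (\<forall>E\<in>#F. isomorphic_varieties E (projective_space 1)) \<and>
     (\<forall>E\<in>#F. \<forall>E'\<in>#F. E \<noteq> E' \<longrightarrow>
        meet_transversely X E E' \<and> (\<forall>p\<in>E \<inter> E'. \<forall>q\<in>E \<inter> E'. p = q)) \<and>
     snd (dual_graph F) =
       {{C, S 1}, {C, M 1}, {M 1, M 2}, {M 2, M 3}, {C, L 1}, {L 1, L 2}, {L 2, L 3}}"

definition central_divisor ::
  "'c \<Rightarrow> (nat \<Rightarrow> 'c) \<Rightarrow> (nat \<Rightarrow> 'c) \<Rightarrow> (nat \<Rightarrow> 'c) \<Rightarrow> nat \<Rightarrow> nat \<Rightarrow> nat \<Rightarrow> 'c multiset" where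
  "central_divisor C S M L \<alpha> \<beta> \<gamma> =
     {#C#} + (\<Sum>i=1..\<alpha>. {#S i#}) + (\<Sum>i=1..\<beta>. {#M i#}) + (\<Sum>i=1..\<gamma>. {#L i#})"

text \<open>
  \<open>T\<close> is a disjoint union of consecutive subchains \<open>N\<^sub>p - \<dots> - N\<^sub>q\<close> of \<open>N\<^sub>l\<^sub>o - \<dots> - N\<^sub>h\<^sub>i\<close>, listed in
  increasing order and separated by at least one unused vertex.
\<close>

definition union_of_subchains :: "(nat \<Rightarrow> 'c) \<Rightarrow> nat \<Rightarrow> nat \<Rightarrow> 'c multiset \<Rightarrow> bool" where
  "union_of_subchains N lo hi T \<longleftrightarrow>
     (\<exists>pqs. (\<forall>(p, q)\<in>set pqs. lo \<le> p \<and> p \<le> q \<and> q \<le> hi) \<and>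
        sorted_wrt (\<lambda>(p, q) (p', q'). q + 1 < p') pqs \<and>
        T = (\<Sum>(p, q)\<leftarrow>pqs. \<Sum>k=p..q. {#N k#}))"

text \<open>The integers avoid truncated subtraction on the natural numbers when \<open>\<beta> = 3\<close>.\<close>

definition tail_condition :: "(nat \<Rightarrow> 'p set) \<Rightarrow> nat \<Rightarrow> 'p set multiset \<Rightarrow> bool" where
  "tail_condition N \<beta> T \<longleftrightarrow>
     (T = {#} \<or> union_of_subchains N (\<beta> + 2) 3 T) \<and>
     (T \<noteq> {#} \<longrightarrow>
        (\<exists>\<mu>s. \<mu>s \<noteq> [] \<and> (\<forall>\<mu>\<in>set \<mu>s. 1 \<le> \<mu>) \<and> has_type T (mset (map DynA \<mu>s)) \<and>
           int (sum_list \<mu>s) + int (length \<mu>s) - 1 \<le> 2 - int \<beta>))"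

definition interchange_branches :: "(nat \<Rightarrow> 'c) \<Rightarrow> (nat \<Rightarrow> 'c) \<Rightarrow> 'c multiset \<Rightarrow> 'c multiset" where
  "interchange_branches M L =
     image_mset (Transposition.transpose (M 1) (L 1) \<circ> Transposition.transpose (M 2) (L 2) \<circ>
                 Transposition.transpose (M 3) (L 3))"

end

theory Submission
  imports Defs
begin

text \<open>
  The full fiber is orthogonal to each of its components, that is, its multiplicities form a positive
  weight on its dual graph for which twice the value at a vertex is the sum of the values at its
  neighbours. A Dynkin diagram, being negative definite, carries no such weight, so an ADER is
  never all of \<open>F\<close>. Every proper connected part containing \<open>C\<close> is a star with arms of lengths
  \<open>\<alpha>\<close>, \<open>\<beta>\<close>, \<open>\<gamma>\<close>, and the arms determine the Dynkin type. Maximality of \<open>\<Gamma>\<close> leaves the next vertex of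
  each branch unused, so that the tails live on the rest of the \<open>M\<close>- and \<open>L\<close>-chains.
\<close>

section \<open>Types of dual graphs\<close>

text \<open>An ADER comes with an unknown graph isomorphism onto an unknown list of Dynkin diagrams,
  so \<open>\<beta> = \<gamma> = 3\<close> cannot be excluded by comparison with one diagram. The
  null weight handles all lists at once because it restricts to any single summand. For every other
  triple the type is found by an explicit numbering of the curves, and the tails are added as
  further summands. The symmetry of the two long branches is used in two different ways. The
  incidence pattern of the eight curves does not change when the names \<open>M\<close> and
  \<open>L\<close> are exchanged, which transfers lemmas from one branch to the other. The operation
  \<open>interchange_branches\<close>, by contrast, moves a divisor; its image is recognised as a
  divisor of the same shape for the exchanged names, so that no isomorphism of dual graphs has to be
  carried along.\<close>

lemma dual_graph_edge:
  "{x, y} \<in> snd (dual_graph R) \<longleftrightarrow> x \<in># R \<and> y \<in># R \<and> x \<noteq> y \<and> x \<inter> y \<noteq> {}"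
  unfolding dual_graph_def by (auto simp: doubleton_eq_iff)

lemma fst_dual_graph [simp]: "fst (dual_graph R) = set_mset R"
  by (simp add: dual_graph_def)

lemma disjoint_union_graph_vertex:
  "p \<in> fst (disjoint_union_graph Gs) \<longleftrightarrow> fst p < length Gs \<and> snd p \<in> fst (Gs ! fst p)"
  unfolding disjoint_union_graph_def by (cases p) auto

lemma disjoint_union_graph_edge:
  "{p, q} \<in> snd (disjoint_union_graph Gs) \<longleftrightarrow>
     fst p < length Gs \<and> fst p = fst q \<and> {snd p, snd q} \<in> snd (Gs ! fst p)"
  unfolding disjoint_union_graph_def
  by (cases p; cases q) (auto simp: doubleton_eq_iff insert_commute)

lemma has_type_empty: "has_type {#} {#}"
  unfolding has_type_def graph_isomorphic_def disjoint_union_graph_def by (auto simp: bij_betw_def)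

text \<open>The two separation hypotheses concern different levels: \<open>disj\<close> compares the
  curves as elements and makes the glued map well defined, while \<open>sep\<close> compares their
  points and excludes edges between the two parts.\<close>

lemma has_type_add:
  assumes R: "has_type R T" and R': "has_type R' T'"
    and disj: "set_mset R \<inter> set_mset R' = {}"
    and sep: "\<And>x y. x \<in># R \<Longrightarrow> y \<in># R' \<Longrightarrow> x \<inter> y = {}"
  shows "has_type (R + R') (T + T')"
proof -
  obtain ts f where ts: "mset ts = T" "\<forall>t\<in>set ts. dynkin_type t"
    and f: "bij_betw f (set_mset R) (fst (disjoint_union_graph (map dynkin_diagram ts)))"
    and fe: "\<And>x y. x \<in># R \<Longrightarrow> y \<in># R \<Longrightarrow> {x, y} \<in> snd (dual_graph R) \<longleftrightarrow>
        {f x, f y} \<in> snd (disjoint_union_graph (map dynkin_diagram ts))"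
    using R unfolding has_type_def graph_isomorphic_def by auto
  obtain ts' f' where ts': "mset ts' = T'" "\<forall>t\<in>set ts'. dynkin_type t"
    and f': "bij_betw f' (set_mset R') (fst (disjoint_union_graph (map dynkin_diagram ts')))"
    and fe': "\<And>x y. x \<in># R' \<Longrightarrow> y \<in># R' \<Longrightarrow> {x, y} \<in> snd (dual_graph R') \<longleftrightarrow>
        {f' x, f' y} \<in> snd (disjoint_union_graph (map dynkin_diagram ts'))"
    using R' unfolding has_type_def graph_isomorphic_def by auto
  let ?G = "disjoint_union_graph (map dynkin_diagram ts)"
  let ?G' = "disjoint_union_graph (map dynkin_diagram ts')"
  let ?H = "disjoint_union_graph (map dynkin_diagram (ts @ ts'))"
  \<comment> \<open>In the concatenated list the diagrams of \<open>ts'\<close> come after those of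
    \<open>ts\<close>, so their tags move up by \<open>length ts\<close>. Shifted and unshifted tags
    never agree, which is why mixed pairs give no edge.\<close>
  define s :: "nat \<times> nat \<Rightarrow> nat \<times> nat" where "s = (\<lambda>(i, v). (length ts + i, v))"
  define h where "h x = (if x \<in># R then f x else s (f' x))" for x
  have s: "inj_on s A" for A
    by (auto simp: s_def inj_on_def)
  have fst_H: "fst ?H = fst ?G \<union> s ` fst ?G'"
  proof (intro set_eqI)
    fix p
    have "p \<in> s ` fst ?G' \<longleftrightarrow> fst p \<ge> length ts \<and> (fst p - length ts, snd p) \<in> fst ?G'"
      by (cases p) (force simp: s_def image_iff)
    then show "p \<in> fst ?H \<longleftrightarrow> p \<in> fst ?G \<union> s ` fst ?G'"
      by (auto simp: disjoint_union_graph_vertex nth_append)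
  qed
  have f_in: "fst (f x) < length ts" if "x \<in># R" for x
    using bij_betwE[OF f] that by (auto simp: disjoint_union_graph_vertex)
  have f'_in: "fst (f' x) < length ts'" if "x \<in># R'" for x
    using bij_betwE[OF f'] that by (auto simp: disjoint_union_graph_vertex)
  have h: "h x = f x" if "x \<in># R" for x using that by (simp add: h_def)
  have h': "h x = s (f' x)" if "x \<in># R'" for x using that disj by (auto simp: h_def)
  have "bij_betw h (set_mset R) (fst ?G)"
    using f h by (simp cong: bij_betw_cong)
  moreover have "bij_betw h (set_mset R') (s ` fst ?G')"
  proof -
    have "bij_betw (s \<circ> f') (set_mset R') (s ` fst ?G')"
      using f' s by (intro bij_betw_trans[of _ _ "fst ?G'"]) (auto simp: bij_betw_def)
    then show ?thesis using h' by (simp cong: bij_betw_cong)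
  qed
  moreover have "fst ?G \<inter> s ` fst ?G' = {}"
    by (auto simp: disjoint_union_graph_vertex s_def split: prod.splits)
  ultimately have bij: "bij_betw h (set_mset (R + R')) (fst ?H)"
    unfolding fst_H set_mset_union by (rule bij_betw_combine)
  have edge: "{x, y} \<in> snd (dual_graph (R + R')) \<longleftrightarrow> {h x, h y} \<in> snd ?H"
    if xy: "x \<in># R + R'" "y \<in># R + R'" for x y
  proof -
    consider "x \<in># R" "y \<in># R" | "x \<in># R'" "y \<in># R'"
      | "x \<in># R" "y \<in># R'" | "x \<in># R'" "y \<in># R"
      using xy by auto
    then show ?thesis
    proof cases
      case 1
      then show ?thesis
        using fe[of x y] f_in[of x]
        by (auto simp: h disjoint_union_graph_edge dual_graph_edge nth_append)
    next
      case 2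
      then show ?thesis
        using fe'[of x y] f'_in[of x]
        by (auto simp: h' disjoint_union_graph_edge dual_graph_edge nth_append s_def
            split: prod.splits)
    next
      case 3
      then show ?thesis
        using sep[of x y] f_in[of x]
        by (auto simp: h h' disjoint_union_graph_edge dual_graph_edge s_def split: prod.splits)
    next
      case 4
      then show ?thesis
        using sep[of y x] f_in[of y]
        by (auto simp: h h' disjoint_union_graph_edge dual_graph_edge s_def split: prod.splits)
    qed
  qed
  have "graph_isomorphic (dual_graph (R + R')) ?H"
    unfolding graph_isomorphic_def fst_dual_graph using bij edge by blast
  moreover have "mset (ts @ ts') = T + T'" using ts ts' by simp
  moreover have "\<forall>t\<in>set (ts @ ts'). dynkin_type t" using ts ts' by auto
  ultimately show ?thesis unfolding has_type_def by blast
qed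

text \<open>\<open>has_type\<close> wants a map from curves to vertices, but a concrete numbering is
  easier to give from vertices to curves; the inverse is taken here once. Edges are unordered and
  there are no loops, so testing pairs with \<open>i < j\<close> is enough.\<close>

lemma has_type_singleI:
  assumes t: "dynkin_type t"
    and g: "bij_betw g (fst (dynkin_diagram t)) (set_mset R)"
    and loop: "\<And>i. {i} \<notin> snd (dynkin_diagram t)"
    and edge: "\<And>i j. \<lbrakk>i \<in> fst (dynkin_diagram t); j \<in> fst (dynkin_diagram t); i < j\<rbrakk>
      \<Longrightarrow> g i \<inter> g j \<noteq> {} \<longleftrightarrow> {i, j} \<in> snd (dynkin_diagram t)"
  shows "has_type R {#t#}"
proof -
  let ?V = "fst (dynkin_diagram t)"
  have edge': "{g i, g j} \<in> snd (dual_graph R) \<longleftrightarrow> {i, j} \<in> snd (dynkin_diagram t)"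
    if "i \<in> ?V" "j \<in> ?V" for i j
  proof -
    have "g i = g j \<longleftrightarrow> i = j" "g i \<in># R" "g j \<in># R"
      using g that by (auto simp: bij_betw_def inj_on_def)
    then show ?thesis
      using edge[of i j] edge[of j i] that loop[of i] dual_graph_edge[of "g i" "g j" R]
      by (cases i j rule: linorder_cases) (simp_all add: insert_commute Int_commute)
  qed
  let ?f = "\<lambda>x. (0::nat, the_inv_into ?V g x)"
  have inv: "bij_betw (the_inv_into ?V g) (set_mset R) ?V"
    using g by (rule bij_betw_the_inv_into)
  have "fst (disjoint_union_graph [dynkin_diagram t]) = Pair 0 ` ?V"
    by (auto simp: disjoint_union_graph_vertex image_iff set_eq_iff)
  moreover have "bij_betw ?f (set_mset R) (Pair 0 ` ?V)"
    using bij_betw_trans[OF inv, of "Pair (0::nat)" "Pair 0 ` ?V"]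
    by (auto simp: bij_betw_def inj_on_def o_def)
  moreover have "{x, y} \<in> snd (dual_graph R) \<longleftrightarrow>
      {?f x, ?f y} \<in> snd (disjoint_union_graph [dynkin_diagram t])"
    if "x \<in># R" "y \<in># R" for x y
  proof -
    have "the_inv_into ?V g z \<in> ?V \<and> g (the_inv_into ?V g z) = z" if "z \<in># R" for z
      using that g inv by (auto simp: bij_betw_def f_the_inv_into_f)
    then show ?thesis
      using edge'[of "the_inv_into ?V g x" "the_inv_into ?V g y"] that
      by (simp add: disjoint_union_graph_edge)
  qed
  ultimately have "graph_isomorphic (dual_graph R) (disjoint_union_graph (map dynkin_diagram [t]))"
    unfolding graph_isomorphic_def by auto
  then show ?thesis unfolding has_type_def using t by (intro exI[of _ "[t]"]) auto
qed

section \<open>Chains of curves, with or without one branching curve\<close>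

text \<open>The recursive form lets simplification reduce an explicit list to finitely many
  intersection tests. For an empty tail the quantifier is vacuous, so the value of
  \<open>hd []\<close> does not matter.\<close>

primrec curve_chain :: "'p set list \<Rightarrow> bool" where
  "curve_chain [] \<longleftrightarrow> True"
| "curve_chain (x # xs) \<longleftrightarrow>
     x \<notin> set xs \<and> (\<forall>y\<in>set xs. x \<inter> y \<noteq> {} \<longleftrightarrow> y = hd xs) \<and> curve_chain xs"

lemma curve_chain_distinct: "curve_chain xs \<Longrightarrow> distinct xs"
  by (induction xs) auto

lemma curve_chain_nth:
  "curve_chain xs \<Longrightarrow> i < j \<Longrightarrow> j < length xs \<Longrightarrow> xs ! i \<inter> xs ! j \<noteq> {} \<longleftrightarrow> j = Suc i"
proof (induction xs arbitrary: i j)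
  case (Cons x xs)
  obtain j' where j: "j = Suc j'" using Cons.prems by (cases j) auto
  show ?case
  proof (cases i)
    case 0
    have "xs ! j' = hd xs \<longleftrightarrow> j' = 0"
      using Cons.prems j curve_chain_distinct[of xs] nth_eq_iff_index_eq[of xs j' 0]
        hd_conv_nth[of xs] by fastforce
    then show ?thesis using Cons.prems j 0 by auto
  next
    case (Suc i')
    then show ?thesis using Cons.prems j Cons.IH[of i' j'] by simp
  qed
qed simp

lemma bij_betw_nth_from_1:
  "distinct xs \<Longrightarrow> bij_betw (\<lambda>i. xs ! (i - 1)) {1..length xs} (set xs)"
proof -
  assume "distinct xs"
  then have "bij_betw ((!) xs) {..<length xs} (set xs)"
    by (rule bij_betw_nth) simp_all
  moreover have "bij_betw (\<lambda>i. i - 1) {1..length xs} {..<length xs}"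
    by (rule bij_betw_byWitness[of _ Suc]) auto
  ultimately show ?thesis
    using bij_betw_trans by (fastforce simp: o_def)
qed

lemma has_type_chain:
  assumes "curve_chain xs" "xs \<noteq> []" "set_mset R = set xs"
  shows "has_type R {#DynA (length xs)#}"
proof (rule has_type_singleI)
  show "dynkin_type (DynA (length xs))" using assms by (cases xs) auto
  show "bij_betw (\<lambda>i. xs ! (i - 1)) (fst (dynkin_diagram (DynA (length xs)))) (set_mset R)"
    using assms(3) bij_betw_nth_from_1[OF curve_chain_distinct[OF assms(1)]] by simp
  fix i j
  assume "i \<in> fst (dynkin_diagram (DynA (length xs)))"
    "j \<in> fst (dynkin_diagram (DynA (length xs)))" "i < j"
  then show "xs ! (i - 1) \<inter> xs ! (j - 1) \<noteq> {} \<longleftrightarrow>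
      {i, j} \<in> snd (dynkin_diagram (DynA (length xs)))"
    using curve_chain_nth[OF assms(1), of "i - 1" "j - 1"]
    by (auto simp: doubleton_eq_iff)
qed (auto simp: doubleton_eq_iff)

text \<open>The families D and E are both a chain with one extra last vertex and differ only in
  where it is attached, so one lemma serves both. List positions start at 0 and diagram vertices at
  1, hence \<open>k + 1\<close>.\<close>

lemma has_type_branched_chain:
  assumes chain: "curve_chain xs" and k: "k < length xs"
    and y: "y \<notin> set xs" "\<And>i. i < length xs \<Longrightarrow> xs ! i \<inter> y \<noteq> {} \<longleftrightarrow> i = k"
    and R: "set_mset R = insert y (set xs)"
    and t: "dynkin_type t"
    and diagram: "dynkin_diagram t = ({1..length xs + 1},
      {{i, i + 1} | i. 1 \<le> i \<and> i + 1 < length xs + 1} \<union> {{k + 1, length xs + 1}})"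
  shows "has_type R {#t#}"
proof (rule has_type_singleI[OF t])
  let ?g = "\<lambda>i. (xs @ [y]) ! (i - 1)"
  show "bij_betw ?g (fst (dynkin_diagram t)) (set_mset R)"
    using bij_betw_nth_from_1[of "xs @ [y]"] curve_chain_distinct[OF chain] y(1) R
    by (simp add: diagram)
  show "{i} \<notin> snd (dynkin_diagram t)" for i
    using k by (auto simp: diagram doubleton_eq_iff)
  fix i j
  assume ij: "i \<in> fst (dynkin_diagram t)" "j \<in> fst (dynkin_diagram t)" "i < j"
  show "?g i \<inter> ?g j \<noteq> {} \<longleftrightarrow> {i, j} \<in> snd (dynkin_diagram t)"
  proof (cases "j = length xs + 1")
    case True
    then show ?thesis
      using ij k y(2)[of "i - 1"] by (auto simp: diagram doubleton_eq_iff nth_append)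
  next
    case False
    then show ?thesis
      using ij k curve_chain_nth[OF chain, of "i - 1" "j - 1"]
      by (auto simp: diagram doubleton_eq_iff nth_append)
  qed
qed

section \<open>Negative definiteness of Dynkin diagrams\<close>

lemma dynkin_vertices:
  "fst (dynkin_diagram (DynA k)) = {1..k}"
  "fst (dynkin_diagram (DynD k)) = {1..k}"
  "fst (dynkin_diagram (DynE k)) = {1..k}"
  by simp_all

lemma dynkin_edges:
  "{i, j} \<in> snd (dynkin_diagram (DynA k)) \<longleftrightarrow>
     j = i + 1 \<and> 1 \<le> i \<and> j \<le> k \<or> i = j + 1 \<and> 1 \<le> j \<and> i \<le> k"
  "{i, j} \<in> snd (dynkin_diagram (DynD k)) \<longleftrightarrow>
     j = i + 1 \<and> 1 \<le> i \<and> j < k \<or> i = j + 1 \<and> 1 \<le> j \<and> i < k \<or>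
     i = k - 2 \<and> j = k \<or> i = k \<and> j = k - 2"
  "{i, j} \<in> snd (dynkin_diagram (DynE k)) \<longleftrightarrow>
     j = i + 1 \<and> 1 \<le> i \<and> j < k \<or> i = j + 1 \<and> 1 \<le> j \<and> i < k \<or>
     i = 3 \<and> j = k \<or> i = k \<and> j = 3"
  by (auto simp: doubleton_eq_iff)

lemmas dynkin_graph = dynkin_vertices dynkin_edges

text \<open>With a virtual value 0 at index 0, \<open>first\<close> is the recurrence at index 1.
  Vanishing second differences then force a line through the origin with slope
  \<open>x 1\<close>.\<close>

lemma linear_of_second_difference_zero:
  fixes x :: "nat \<Rightarrow> real"
  assumes first: "2 \<le> m \<Longrightarrow> x 2 = 2 * x 1"
    and rec: "\<And>i. 2 \<le> i \<Longrightarrow> i < m \<Longrightarrow> 2 * x i = x (i - 1) + x (i + 1)"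
    and "1 \<le> i" "i \<le> m"
  shows "x i = real i * x 1"
  using assms(3,4)
proof (induction i rule: less_induct)
  case (less i)
  consider "i = 1" | "i = 2" | "i \<ge> 3" using less.prems by linarith
  then show ?case
  proof cases
    case 3
    then obtain j where j: "i = j + 2" "j \<ge> 1"
      using that[of "i - 2"] by linarith
    have "x (j + 1) = real (j + 1) * x 1" "x j = real j * x 1"
      using less.IH[of "j + 1"] less.IH[of j] less.prems j by simp_all
    moreover have "2 * x (j + 1) = x j + x (j + 2)"
      using rec[of "j + 1"] less.prems j by simp
    ultimately show ?thesis using j by (simp add: algebra_simps)
  qed (use less.prems first in auto)
qed

text \<open>
  Negative definiteness of the Dynkin diagrams. Starting from vertex 1 the weight must grow linearly
  up to the branch vertex or the end of the chain, where the condition then fails.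
\<close>

lemma dynkin_no_null_weight:
  fixes x :: "nat \<Rightarrow> real"
  assumes t: "dynkin_type t"
    and pos: "\<And>v. v \<in> fst (dynkin_diagram t) \<Longrightarrow> x v > 0"
    and null: "\<And>v. v \<in> fst (dynkin_diagram t) \<Longrightarrow>
      2 * x v = (\<Sum>w | w \<in> fst (dynkin_diagram t) \<and> {v, w} \<in> snd (dynkin_diagram t). x w)"
  shows False
proof -
  have null_at: "2 * x v = sum x N"
    if "v \<in> fst (dynkin_diagram t)"
      "{w. w \<in> fst (dynkin_diagram t) \<and> {v, w} \<in> snd (dynkin_diagram t)} = N" for v N
    using null[OF that(1)] that(2) by simp
  show False
  proof (cases t)
    case (DynA k)
    have k: "1 \<le> k" using t DynA by simp
    have inner: "2 * x i = x (i - 1) + x (i + 1)" if "2 \<le> i" "i < k" for i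
      by (subst null_at[of i "{i - 1, i + 1}"])
        (use that in \<open>auto simp: DynA dynkin_graph simp del: dynkin_diagram.simps\<close>)
    have first: "x 2 = 2 * x 1" if "2 \<le> k"
      by (subst null_at[of 1 "{2}"])
        (use that in \<open>auto simp: DynA dynkin_graph simp del: dynkin_diagram.simps\<close>)
    have lin: "x i = real i * x 1" if "1 \<le> i" "i \<le> k" for i
      using linear_of_second_difference_zero[of k x i, OF first inner] that by blast
    have "x 1 > 0" using pos[of 1] k by (simp add: DynA)
    show False
    proof (cases "k = 1")
      case True
      then have "2 * x 1 = 0"
        by (subst null_at[of 1 "{}"])
        (auto simp: DynA dynkin_graph simp del: dynkin_diagram.simps)
      with \<open>x 1 > 0\<close> show False by simp
    next
      case False
      then have "2 * x k = x (k - 1)"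
        by (subst null_at[of k "{k - 1}"])
        (use k in \<open>auto simp: DynA dynkin_graph simp del: dynkin_diagram.simps\<close>)
      moreover have "x k = real k * x 1" "x (k - 1) = real (k - 1) * x 1"
        using lin[of k] lin[of "k - 1"] k False by simp_all
      \<comment> \<open>The end condition says that the linear continuation vanishes at
        \<open>k + 1\<close>, whereas its value there is \<open>(k + 1) * x 1\<close>.\<close>
      ultimately have "(real k + 1) * x 1 = 0"
        using k by (simp add: of_nat_diff algebra_simps)
      with \<open>x 1 > 0\<close> show False by (simp add: add_nonneg_eq_0_iff)
    qed
  next
    case (DynD l)
    \<comment> \<open>In terms of \<open>m\<close> the branch vertex is \<open>m + 2\<close>, the
      two short ends are \<open>m + 3\<close> and \<open>m + 4\<close>, and no truncated subtraction
      remains.\<close>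
    then obtain m where l: "l = m + 4" using t by (auto simp: le_iff_add add.commute)
    have inner: "2 * x i = x (i - 1) + x (i + 1)" if "2 \<le> i" "i < m + 2" for i
      by (subst null_at[of i "{i - 1, i + 1}"])
        (use that in \<open>auto simp: DynD l dynkin_graph simp del: dynkin_diagram.simps\<close>)
    have first: "x 2 = 2 * x 1"
      by (subst null_at[of 1 "{2}"])
        (auto simp: DynD l dynkin_graph simp del: dynkin_diagram.simps)
    have lin: "x i = real i * x 1" if "1 \<le> i" "i \<le> m + 2" for i
      using linear_of_second_difference_zero[of "m + 2" x i, OF first inner] that by blast
    have "x 1 > 0" using pos[of 1] by (simp add: DynD l)
    moreover have "2 * x (m + 3) = x (m + 2)"
      by (subst null_at[of "m + 3" "{m + 2}"])
        (auto simp: DynD l dynkin_graph simp del: dynkin_diagram.simps)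
    moreover have "2 * x (m + 4) = x (m + 2)"
      by (subst null_at[of "m + 4" "{m + 2}"])
        (auto simp: DynD l dynkin_graph simp del: dynkin_diagram.simps)
    moreover have "2 * x (m + 2) = x (m + 1) + x (m + 3) + x (m + 4)"
      by (subst null_at[of "m + 2" "{m + 1, m + 3, m + 4}"])
        (auto simp: DynD l dynkin_graph simp del: dynkin_diagram.simps)
    \<comment> \<open>The two short ends together carry \<open>x (m + 2)\<close>, so the branch
      vertex gives \<open>x (m + 2) = x (m + 1)\<close>, against the positive slope
      \<open>x 1\<close>.\<close>
    ultimately show False
      using lin[of "m + 2"] lin[of "m + 1"] by (simp add: algebra_simps)
  next
    case (DynE n)
    have n: "6 \<le> n" "n \<le> 8" using t DynE by auto
    have "x 1 > 0" using pos[of 1] n by (simp add: DynE)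
    moreover have "2 * x 1 = x 2"
      by (subst null_at[of 1 "{2}"])
        (use n in \<open>auto simp: DynE dynkin_graph simp del: dynkin_diagram.simps\<close>)
    moreover have "2 * x 2 = x 1 + x 3"
      by (subst null_at[of 2 "{1, 3}"])
        (use n in \<open>auto simp: DynE dynkin_graph simp del: dynkin_diagram.simps\<close>)
    moreover have "2 * x 3 = x 2 + x 4 + x n"
      by (subst null_at[of 3 "{2, 4, n}"])
        (use n in \<open>auto simp: DynE dynkin_graph simp del: dynkin_diagram.simps\<close>)
    moreover have "2 * x n = x 3"
      by (subst null_at[of n "{3}"])
        (use n in \<open>auto simp: DynE dynkin_graph simp del: dynkin_diagram.simps\<close>)
    moreover have "2 * x i = x (i - 1) + x (i + 1)" if "4 \<le> i" "i + 1 < n" for i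
      by (subst null_at[of i "{i - 1, i + 1}"])
        (use that in \<open>auto simp: DynE dynkin_graph simp del: dynkin_diagram.simps\<close>)
    note this[of 4] this[of 5] this[of 6]
    moreover have "2 * x (n - 1) = x (n - 2)"
      by (subst null_at[of "n - 1" "{n - 2}"])
        (use n in \<open>auto simp: DynE dynkin_graph simp del: dynkin_diagram.simps\<close>)
    moreover have "n = 6 \<or> n = 7 \<or> n = 8" using n by linarith
    \<comment> \<open>With a = \<open>x 1\<close>, vertex 3 has weight 3a and vertex
      \<open>n\<close> has 3a/2, so from vertex 3 on the chain descends by a/2 per step. The end
      condition asks for the value 0 at position \<open>n\<close>, but the continuation gives (9 -
      n)a/2, which is positive for n at most 8.\<close>
    ultimately show False by auto
  qed
qed

text \<open>Edges of a disjoint union keep the tag, so every curve meeting a curve of the first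
  summand lies in that summand, and the neighbour sums survive restriction.
  \<open>R \<noteq> {#}\<close> guarantees that a first summand exists.\<close>

lemma has_type_no_null_weight:
  fixes m :: "'p set \<Rightarrow> real"
  assumes R: "has_type R T" "R \<noteq> {#}"
    and pos: "\<And>E. E \<in># R \<Longrightarrow> m E > 0"
    and null: "\<And>E. E \<in># R \<Longrightarrow> 2 * m E = (\<Sum>E' | E' \<in># R \<and> E \<noteq> E' \<and> E \<inter> E' \<noteq> {}. m E')"
  shows False
proof -
  obtain ts f where ts: "\<forall>t\<in>set ts. dynkin_type t"
    and f: "bij_betw f (set_mset R) (fst (disjoint_union_graph (map dynkin_diagram ts)))"
    and fe: "\<And>x y. x \<in># R \<Longrightarrow> y \<in># R \<Longrightarrow> {x, y} \<in> snd (dual_graph R) \<longleftrightarrow>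
        {f x, f y} \<in> snd (disjoint_union_graph (map dynkin_diagram ts))"
    using R unfolding has_type_def graph_isomorphic_def by auto
  have "ts \<noteq> []"
    using f R(2) by (auto simp: bij_betw_def disjoint_union_graph_def)
  let ?G = "disjoint_union_graph (map dynkin_diagram ts)"
  let ?t = "ts ! 0"
  let ?V = "fst (dynkin_diagram ?t)"
  define g where "g i = the_inv_into (set_mset R) f (0, i)" for i
  have in_G: "(0, i) \<in> fst ?G" if "i \<in> ?V" for i
    using that \<open>ts \<noteq> []\<close> by (simp add: disjoint_union_graph_vertex)
  have g: "g i \<in># R" "f (g i) = (0, i)" if "i \<in> ?V" for i
    using f in_G[OF that] unfolding g_def bij_betw_def
    by (auto simp: f_the_inv_into_f intro: the_inv_into_into)
  show False
  proof (rule dynkin_no_null_weight[of ?t "m \<circ> g"])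
    show "dynkin_type ?t" using ts \<open>ts \<noteq> []\<close> by simp
    show "(m \<circ> g) v > 0" if "v \<in> ?V" for v using pos g that by simp
    fix v assume v: "v \<in> ?V"
    let ?N = "{w. w \<in> ?V \<and> {v, w} \<in> snd (dynkin_diagram ?t)}"
    \<comment> \<open>The sum over the neighbours of \<open>v\<close> in the diagram is the sum over
      the curves meeting \<open>g v\<close>, reindexed along \<open>g\<close>.\<close>
    have "bij_betw g ?N {E'. E' \<in># R \<and> g v \<noteq> E' \<and> g v \<inter> E' \<noteq> {}}"
    proof (rule bij_betwI')
      show "g w = g w' \<longleftrightarrow> w = w'" if "w \<in> ?N" "w' \<in> ?N" for w w'
        using that g(2) by (metis (no_types, lifting) mem_Collect_eq snd_conv)
      show "g w \<in> {E'. E' \<in># R \<and> g v \<noteq> E' \<and> g v \<inter> E' \<noteq> {}}" if "w \<in> ?N" for w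
        using that fe[of "g v" "g w"] g v \<open>ts \<noteq> []\<close>
        by (auto simp: disjoint_union_graph_edge dual_graph_edge)
      show "\<exists>w\<in>?N. E' = g w" if "E' \<in> {E'. E' \<in># R \<and> g v \<noteq> E' \<and> g v \<inter> E' \<noteq> {}}" for E'
      proof -
        have E': "E' \<in># R" using that by simp
        have e: "{f (g v), f E'} \<in> snd ?G"
          using fe[of "g v" E'] that g v by (simp add: dual_graph_edge)
        have "f E' \<in> fst ?G" using bij_betwE[OF f] E' by simp
        then have "snd (f E') \<in> ?N" "f E' = (0, snd (f E'))"
          using e g(2)[OF v] \<open>ts \<noteq> []\<close>
          by (auto simp: disjoint_union_graph_edge disjoint_union_graph_vertex prod_eq_iff)
        moreover from this have "g (snd (f E')) = E'"
          using f E' unfolding g_def bij_betw_def by (metis the_inv_into_f_f)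
        ultimately show ?thesis by metis
      qed
    qed
    then have "(\<Sum>w\<in>?N. m (g w)) = (\<Sum>E' | E' \<in># R \<and> g v \<noteq> E' \<and> g v \<inter> E' \<noteq> {}. m E')"
      by (rule sum.reindex_bij_betw)
    then show "2 * (m \<circ> g) v = (\<Sum>w\<in>?N. (m \<circ> g) w)"
      using null[of "g v"] g v by simp
  qed
qed

section \<open>Reduced divisors and subchains\<close>

lemma reduced_divisor_eqI:
  assumes "reduced_divisor R" "reduced_divisor R'" "set_mset R = set_mset R'"
  shows "R = R'"
proof (rule multiset_eqI)
  fix x
  have "x \<in># R \<longleftrightarrow> x \<in># R'" using assms(3) by simp
  moreover have "count R x \<le> 1" "count R' x \<le> 1"
    using assms(1,2) by (auto simp: reduced_divisor_def)
  ultimately show "count R x = count R' x"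
    unfolding count_greater_zero_iff [symmetric] by linarith
qed

lemma reduced_divisor_mset: "reduced_divisor (mset xs) \<longleftrightarrow> distinct xs"
  unfolding reduced_divisor_def distinct_count_atmost_1
  by (auto simp: le_Suc_eq count_eq_zero_iff)

lemma reduced_divisor_add: "reduced_divisor (R + R') \<Longrightarrow> reduced_divisor R \<and> reduced_divisor R'"
  unfolding reduced_divisor_def by (auto intro: add_leD1 add_leD2)

lemma reduced_divisor_mono: "R \<subseteq># R' \<Longrightarrow> reduced_divisor R' \<Longrightarrow> reduced_divisor R"
  by (metis reduced_divisor_add subset_mset.add_diff_inverse)

lemma reduced_divisor_add_disjoint:
  assumes "reduced_divisor (R + R')"
  shows "set_mset R \<inter> set_mset R' = {}"
proof -
  have "\<not> (x \<in># R \<and> x \<in># R')" for x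
  proof -
    have "count R x + count R' x \<le> 1" using assms by (simp add: reduced_divisor_def)
    then show ?thesis unfolding count_greater_zero_iff [symmetric] by linarith
  qed
  then show ?thesis by blast
qed

lemma sum_singletons_eq_mset: "(\<Sum>k=p..q. {#f k#}) = mset (map f [p..<q + 1])"
proof (cases "p \<le> q")
  case True
  then show ?thesis by (induction q rule: dec_induct) auto
qed simp

text \<open>In list form reducedness becomes distinctness, and for given arm lengths the divisor
  unfolds to an explicit list.\<close>

lemma central_divisor_eq_mset:
  "central_divisor C S M L \<alpha> \<beta> \<gamma> =
     mset (C # map S [1..<\<alpha> + 1] @ map M [1..<\<beta> + 1] @ map L [1..<\<gamma> + 1])"
  unfolding central_divisor_def sum_singletons_eq_mset by simp

lemma set_central_divisor:
  "set_mset (central_divisor C S M L \<alpha> \<beta> \<gamma>) =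
     insert C (S ` {1..\<alpha>} \<union> M ` {1..\<beta>} \<union> L ` {1..\<gamma>})"
proof -
  have "{1..<n + 1} = {1..n}" for n :: nat by auto
  then show ?thesis
    by (simp only: central_divisor_eq_mset set_mset_mset list.set set_append set_map set_upt Un_assoc)
qed

lemma central_divisor_swap: "central_divisor C S M L \<alpha> \<beta> \<gamma> = central_divisor C S L M \<alpha> \<gamma> \<beta>"
  by (simp add: central_divisor_def add_ac)

lemma set_union_of_subchains:
  assumes "union_of_subchains N lo hi T"
  shows "set_mset T \<subseteq> N ` {lo..hi}"
proof -
  obtain pqs where pqs: "\<forall>(p, q)\<in>set pqs. lo \<le> p \<and> p \<le> q \<and> q \<le> hi"
    and T: "T = (\<Sum>(p, q)\<leftarrow>pqs. \<Sum>k=p..q. {#N k#})"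
    using assms unfolding union_of_subchains_def by blast
  have sum: "set_mset (\<Sum>k=p..q. {#N k#}) = N ` {p..q}" for p q
    by (simp add: set_mset_sum) auto
  have "set_mset (\<Sum>(p, q)\<leftarrow>pqs. \<Sum>k=p..q. {#N k#}) \<subseteq> N ` {lo..hi}"
    using pqs
  proof (induction pqs)
    case (Cons pq pqs)
    then show ?case by (cases pq) (auto simp: sum)
  qed simp
  then show ?thesis by (simp add: T)
qed

lemma set_tail: "tail_condition N \<beta> T \<Longrightarrow> set_mset T \<subseteq> N ` {\<beta> + 2..3}"
  unfolding tail_condition_def using set_union_of_subchains by fastforce

lemma le_3_iff: "n \<le> 3 \<longleftrightarrow> n = 0 \<or> n = 1 \<or> n = 2 \<or> n = (3::nat)"
  by linarith

lemma small_intervals: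
  "{1..0::nat} = {}" "{1..1::nat} = {1}" "{1..2::nat} = {1, 2}" "{1..3::nat} = {1, 2, 3}"
  "{2..3::nat} = {2, 3}"
  by auto

text \<open>The upper bounds keep the shape produced by substituting a value for \<open>n\<close> in
  \<open>n + 1\<close>, so these rules can fire before arithmetic simplification changes the
  terms.\<close>

lemma small_upt:
  "[1..<0 + 1::nat] = []" "[1..<1 + 1::nat] = [1]" "[1..<2 + 1::nat] = [1, 2]"
  "[1..<3 + 1::nat] = [1, 2, 3]"
  by (simp_all add: upt_rec)

section \<open>Configurations of curves with extended dual graph \<open>E\<^sub>7\<close>\<close>

text \<open>Otherwise the simplifier turns the curve \<open>S 1\<close> into \<open>S (Suc 0)\<close>.\<close>

declare One_nat_def [simp del]

text \<open>The equivalence in \<open>meet\<close> covers all pairs of distinct curves, so it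
  supplies the absent edges as well as the present ones; both are needed to identify a dual
  graph.\<close>

locale E7_tilde_configuration =
  fixes C :: "'p set" and S M L :: "nat \<Rightarrow> 'p set"
  assumes distinct: "distinct [C, S 1, M 1, M 2, M 3, L 1, L 2, L 3]"
    and meet: "\<lbrakk>E \<in> {C, S 1, M 1, M 2, M 3, L 1, L 2, L 3};
        E' \<in> {C, S 1, M 1, M 2, M 3, L 1, L 2, L 3}; E \<noteq> E'\<rbrakk> \<Longrightarrow>
      E \<inter> E' \<noteq> {} \<longleftrightarrow> {E, E'} \<in>
        {{C, S 1}, {C, M 1}, {M 1, M 2}, {M 2, M 3}, {C, L 1}, {L 1, L 2}, {L 2, L 3}}"
begin

abbreviation components :: "'p set set" where
  "components \<equiv> {C, S 1, M 1, M 2, M 3, L 1, L 2, L 3}"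

abbreviation central :: "nat \<Rightarrow> nat \<Rightarrow> nat \<Rightarrow> 'p set multiset" where
  "central \<equiv> central_divisor C S M L"

lemma distinct_curves [simp]:
  "C \<noteq> S 1" "C \<noteq> M 1" "C \<noteq> M 2" "C \<noteq> M 3" "C \<noteq> L 1" "C \<noteq> L 2" "C \<noteq> L 3"
  "S 1 \<noteq> M 1" "S 1 \<noteq> M 2" "S 1 \<noteq> M 3" "S 1 \<noteq> L 1" "S 1 \<noteq> L 2" "S 1 \<noteq> L 3"
  "M 1 \<noteq> M 2" "M 1 \<noteq> M 3" "M 2 \<noteq> M 3" "L 1 \<noteq> L 2" "L 1 \<noteq> L 3" "L 2 \<noteq> L 3"
  "M 1 \<noteq> L 1" "M 1 \<noteq> L 2" "M 1 \<noteq> L 3" "M 2 \<noteq> L 1" "M 2 \<noteq> L 2" "M 2 \<noteq> L 3"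
  "M 3 \<noteq> L 1" "M 3 \<noteq> L 2" "M 3 \<noteq> L 3"
  using distinct by simp_all

lemmas distinct_curves_sym [simp] = distinct_curves [symmetric]

text \<open>Exchanging the two long arms is an automorphism of the extended diagram. Interpreting
  the locale through it yields the L-version of each lemma proved for the M-branch.\<close>

lemma swap: "E7_tilde_configuration C S L M"
proof
  show "distinct [C, S 1, L 1, L 2, L 3, M 1, M 2, M 3]" by simp
  have components: "{C, S 1, L 1, L 2, L 3, M 1, M 2, M 3} = components"
    by (simp only: insert_commute)
  have edges: "{{C, S 1}, {C, L 1}, {L 1, L 2}, {L 2, L 3}, {C, M 1}, {M 1, M 2}, {M 2, M 3}} =
      {{C, S 1}, {C, M 1}, {M 1, M 2}, {M 2, M 3}, {C, L 1}, {L 1, L 2}, {L 2, L 3}}"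
    by (simp only: insert_commute)
  show "E \<inter> E' \<noteq> {} \<longleftrightarrow> {E, E'} \<in>
      {{C, S 1}, {C, L 1}, {L 1, L 2}, {L 2, L 3}, {C, M 1}, {M 1, M 2}, {M 2, M 3}}"
    if "E \<in> {C, S 1, L 1, L 2, L 3, M 1, M 2, M 3}"
      "E' \<in> {C, S 1, L 1, L 2, L 3, M 1, M 2, M 3}" "E \<noteq> E'" for E E'
    unfolding edges by (rule meet[OF that[unfolded components]])
qed

text \<open>Simplification reads \<open>E \<inter> E' \<noteq> {}\<close> as a negated equation, so
  \<open>meet\<close> becomes an effective rewrite rule only in this positive form.\<close>

lemma disjoint_iff_no_edge:
  "\<lbrakk>E \<in> components; E' \<in> components; E \<noteq> E'\<rbrakk> \<Longrightarrow>
     E \<inter> E' = {} \<longleftrightarrow> {E, E'} \<notin>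
       {{C, S 1}, {C, M 1}, {M 1, M 2}, {M 2, M 3}, {C, L 1}, {L 1, L 2}, {L 2, L 3}}"
  using meet by metis

section \<open>The curves of a central divisor\<close>

lemma member_central:
  assumes "\<alpha> \<le> 1" "\<beta> \<le> 3" "\<gamma> \<le> 3"
  shows "C \<in># central \<alpha> \<beta> \<gamma>" "S 1 \<in># central \<alpha> \<beta> \<gamma> \<longleftrightarrow> 1 \<le> \<alpha>"
    "M 1 \<in># central \<alpha> \<beta> \<gamma> \<longleftrightarrow> 1 \<le> \<beta>" "M 2 \<in># central \<alpha> \<beta> \<gamma> \<longleftrightarrow> 2 \<le> \<beta>"
    "M 3 \<in># central \<alpha> \<beta> \<gamma> \<longleftrightarrow> 3 \<le> \<beta>"
    "L 1 \<in># central \<alpha> \<beta> \<gamma> \<longleftrightarrow> 1 \<le> \<gamma>" "L 2 \<in># central \<alpha> \<beta> \<gamma> \<longleftrightarrow> 2 \<le> \<gamma>"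
    "L 3 \<in># central \<alpha> \<beta> \<gamma> \<longleftrightarrow> 3 \<le> \<gamma>"
proof -
  have "\<alpha> = 0 \<or> \<alpha> = 1" using assms by linarith
  moreover note assms(2,3)[unfolded le_3_iff]
  ultimately show "C \<in># central \<alpha> \<beta> \<gamma>" "S 1 \<in># central \<alpha> \<beta> \<gamma> \<longleftrightarrow> 1 \<le> \<alpha>"
    "M 1 \<in># central \<alpha> \<beta> \<gamma> \<longleftrightarrow> 1 \<le> \<beta>" "M 2 \<in># central \<alpha> \<beta> \<gamma> \<longleftrightarrow> 2 \<le> \<beta>"
    "M 3 \<in># central \<alpha> \<beta> \<gamma> \<longleftrightarrow> 3 \<le> \<beta>"
    "L 1 \<in># central \<alpha> \<beta> \<gamma> \<longleftrightarrow> 1 \<le> \<gamma>" "L 2 \<in># central \<alpha> \<beta> \<gamma> \<longleftrightarrow> 2 \<le> \<gamma>"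
    "L 3 \<in># central \<alpha> \<beta> \<gamma> \<longleftrightarrow> 3 \<le> \<gamma>"
    by (elim disjE; simp add: set_central_divisor small_intervals)+
qed

lemma central_subset:
  assumes "\<alpha> \<le> 1" "\<beta> \<le> 3" "\<gamma> \<le> 3"
  shows "set_mset (central \<alpha> \<beta> \<gamma>) \<subseteq> components"
proof -
  have "\<alpha> = 0 \<or> \<alpha> = 1" using assms by linarith
  moreover note assms(2,3)[unfolded le_3_iff]
  ultimately show ?thesis
    by (elim disjE; simp add: set_central_divisor small_intervals)
qed

text \<open>Arms are initial segments, so membership of the k-th curve tests whether the arm length
  is at least k. These tests determine a length bounded by 3.\<close>

lemma central_inject:
  assumes "\<alpha> \<le> 1" "\<beta> \<le> 3" "\<gamma> \<le> 3" "\<alpha>' \<le> 1" "\<beta>' \<le> 3" "\<gamma>' \<le> 3"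
    and "set_mset (central \<alpha> \<beta> \<gamma>) = set_mset (central \<alpha>' \<beta>' \<gamma>')"
  shows "\<alpha> = \<alpha>' \<and> \<beta> = \<beta>' \<and> \<gamma> = \<gamma>'"
proof -
  note m = member_central(2-)[OF assms(1-3)] member_central(2-)[OF assms(4-6)]
  have "1 \<le> \<alpha> \<longleftrightarrow> 1 \<le> \<alpha>'" "1 \<le> \<beta> \<longleftrightarrow> 1 \<le> \<beta>'" "2 \<le> \<beta> \<longleftrightarrow> 2 \<le> \<beta>'" "3 \<le> \<beta> \<longleftrightarrow> 3 \<le> \<beta>'"
    "1 \<le> \<gamma> \<longleftrightarrow> 1 \<le> \<gamma>'" "2 \<le> \<gamma> \<longleftrightarrow> 2 \<le> \<gamma>'" "3 \<le> \<gamma> \<longleftrightarrow> 3 \<le> \<gamma>'"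
    by (simp_all only: m [symmetric] assms(7))
  then show ?thesis using assms(1-6) by linarith
qed

lemma reduced_central:
  assumes "\<alpha> \<le> 1" "\<beta> \<le> 3" "\<gamma> \<le> 3"
  shows "reduced_divisor (central \<alpha> \<beta> \<gamma>)"
proof -
  have "\<alpha> = 0 \<or> \<alpha> = 1" using assms by linarith
  moreover note assms(2,3)[unfolded le_3_iff]
  ultimately show ?thesis
    unfolding central_divisor_eq_mset reduced_divisor_mset
    by (elim disjE; simp only: small_upt; simp)
qed

section \<open>Dynkin types of the central divisors\<close>

text \<open>Without \<open>S 1\<close> the divisor is a path: the M-arm read inwards, then
  \<open>C\<close>, then the L-arm read outwards.\<close>

lemma central_chain_without_S:
  assumes "\<beta> \<le> 3" "\<gamma> \<le> 3"
  shows "has_type (central 0 \<beta> \<gamma>) {#DynA (1 + \<beta> + \<gamma>)#}"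
proof -
  let ?xs = "map M (rev [1..<\<beta> + 1]) @ C # map L [1..<\<gamma> + 1]"
  have "curve_chain ?xs"
    using assms[unfolded le_3_iff]
    by (elim disjE; simp only: small_upt; simp add: disjoint_iff_no_edge doubleton_eq_iff)
  moreover have "set_mset (central 0 \<beta> \<gamma>) = set ?xs"
    by (auto simp: central_divisor_eq_mset)
  ultimately show ?thesis
    using has_type_chain[of ?xs] by (simp add: add_ac Suc_eq_plus1)
qed

lemma central_chain_without_M:
  assumes "\<gamma> \<le> 3"
  shows "has_type (central 1 0 \<gamma>) {#DynA (2 + \<gamma>)#}"
proof -
  let ?xs = "S 1 # C # map L [1..<\<gamma> + 1]"
  have "curve_chain ?xs"
    using assms[unfolded le_3_iff]
    by (elim disjE; simp only: small_upt; simp add: disjoint_iff_no_edge doubleton_eq_iff)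
  moreover have "set_mset (central 1 0 \<gamma>) = set ?xs"
    unfolding central_divisor_eq_mset small_upt by auto
  ultimately show ?thesis
    using has_type_chain[of ?xs] by simp
qed

lemma central_type_A:
  assumes "\<alpha> \<le> 1" "\<beta> \<le> 3" "\<gamma> \<le> 3" "\<not> (\<alpha> \<noteq> 0 \<and> \<beta> \<noteq> 0 \<and> \<gamma> \<noteq> 0)"
  shows "has_type (central \<alpha> \<beta> \<gamma>) {#DynA (1 + \<alpha> + \<beta> + \<gamma>)#}"
proof -
  interpret swap: E7_tilde_configuration C S L M by (rule swap)
  consider "\<alpha> = 0" | "\<alpha> = 1" "\<beta> = 0" | "\<alpha> = 1" "\<gamma> = 0" using assms by linarith
  then show ?thesis
    using central_chain_without_S[of \<beta> \<gamma>] central_chain_without_M[of \<gamma>]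
      swap.central_chain_without_M[of \<beta>] assms
    by cases (simp_all add: central_divisor_swap[of C S L M])
qed

lemma central_type_D:
  assumes "1 \<le> \<gamma>" "\<gamma> \<le> 3"
  shows "has_type (central 1 1 \<gamma>) {#DynD (\<gamma> + 3)#}"
proof -
  \<comment> \<open>The long arm is read inwards, so \<open>C\<close> has list position \<gamma> and
    only \<open>M 1\<close> follows it. This is the penultimate vertex of the chain, where the
    diagram of type D attaches its last vertex, here \<open>S 1\<close>.\<close>
  let ?xs = "map L (rev [1..<\<gamma> + 1]) @ [C, M 1]"
  have g: "\<gamma> = 1 \<or> \<gamma> = 2 \<or> \<gamma> = 3" using assms by linarith
  show ?thesis
  proof (rule has_type_branched_chain[of ?xs \<gamma> "S 1"])
    show "curve_chain ?xs"
      using g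
      by (elim disjE; simp only: small_upt; simp add: disjoint_iff_no_edge doubleton_eq_iff)
    show "S 1 \<notin> set ?xs"
      using g by (elim disjE; simp only: small_upt; simp)
    show "?xs ! i \<inter> S 1 \<noteq> {} \<longleftrightarrow> i = \<gamma>" if "i < length ?xs" for i
    proof -
      have "i = 0 \<or> i = 1 \<or> i = 2 \<or> i = 3 \<or> i = 4" using that g by auto
      then show ?thesis
        using g that
        by (elim disjE; simp only: small_upt;
            simp add: nth_Cons' disjoint_iff_no_edge doubleton_eq_iff)
    qed
    show "set_mset (central 1 1 \<gamma>) = insert (S 1) (set ?xs)"
      unfolding central_divisor_eq_mset small_upt by auto
  qed (use assms in auto)
qed

lemma central_type_E:
  assumes "2 \<le> \<gamma>" "\<gamma> \<le> 3"
  shows "has_type (central 1 2 \<gamma>) {#DynE (\<gamma> + 4)#}"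
proof -
  \<comment> \<open>The arm of length 2 comes first, which makes \<open>C\<close> the third vertex,
    where the diagram of type E attaches its last vertex.\<close>
  let ?xs = "[M 2, M 1, C] @ map L [1..<\<gamma> + 1]"
  have g: "\<gamma> = 2 \<or> \<gamma> = 3" using assms by linarith
  show ?thesis
  proof (rule has_type_branched_chain[of ?xs 2 "S 1"])
    show "curve_chain ?xs"
      using g
      by (elim disjE; simp only: small_upt; simp add: disjoint_iff_no_edge doubleton_eq_iff)
    show "S 1 \<notin> set ?xs"
      using g by (elim disjE; simp only: small_upt; simp)
    show "?xs ! i \<inter> S 1 \<noteq> {} \<longleftrightarrow> i = 2" if "i < length ?xs" for i
    proof -
      have "i = 0 \<or> i = 1 \<or> i = 2 \<or> i = 3 \<or> i = 4 \<or> i = 5" using that g by auto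
      then show ?thesis
        using g that
        by (elim disjE; simp only: small_upt;
            simp add: nth_Cons' disjoint_iff_no_edge doubleton_eq_iff)
    qed
    show "set_mset (central 1 2 \<gamma>) = insert (S 1) (set ?xs)"
      unfolding central_divisor_eq_mset small_upt by auto
  qed (use assms g in auto)
qed

lemma central_type_DE:
  assumes "\<beta> \<le> 3" "\<gamma> \<le> 3" "\<beta> \<noteq> 0" "\<gamma> \<noteq> 0"
    and "\<beta>' = min \<beta> \<gamma>" "\<gamma>' = max \<beta> \<gamma>"
  shows "\<beta>' = 1 \<Longrightarrow> has_type (central 1 \<beta> \<gamma>) {#DynD (\<gamma>' + 3)#}"
    and "\<beta>' = 2 \<Longrightarrow> has_type (central 1 \<beta> \<gamma>) {#DynE (\<gamma>' + 4)#}"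
proof -
  interpret swap: E7_tilde_configuration C S L M by (rule swap)
  have c: "central 1 \<beta> \<gamma> = central 1 \<beta>' \<gamma>' \<or> central 1 \<beta> \<gamma> = swap.central 1 \<beta>' \<gamma>'"
    using assms(5,6) by (auto simp: min_def max_def central_divisor_swap[of C S L M])
  have "\<beta>' \<le> \<gamma>'" "\<gamma>' \<le> 3" using assms by auto
  with c show "\<beta>' = 1 \<Longrightarrow> has_type (central 1 \<beta> \<gamma>) {#DynD (\<gamma>' + 3)#}"
    and "\<beta>' = 2 \<Longrightarrow> has_type (central 1 \<beta> \<gamma>) {#DynE (\<gamma>' + 4)#}"
    using central_type_D[of \<gamma>'] swap.central_type_D[of \<gamma>']
      central_type_E[of \<gamma>'] swap.central_type_E[of \<gamma>']
    by auto
qed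

lemma has_no_type_if_all_components:
  assumes "set_mset R = components"
  shows "\<not> has_type R T"
proof
  assume R: "has_type R T"
  \<comment> \<open>the multiplicities of the components in the fiber\<close>
  define m :: "'p set \<Rightarrow> real" where
    "m E = (if E = C then 4 else if E \<in> {M 1, L 1} then 3 else if E \<in> {S 1, M 2, L 2} then 2
      else 1)"
    for E
  \<comment> \<open>Each neighbour set is checked by testing the members of \<open>R\<close> one by
    one, which leaves only incidences between named curves.\<close>
  have neighbours: "{E'. E' \<in># R \<and> E \<noteq> E' \<and> E \<inter> E' \<noteq> {}} = N"
    if "N \<subseteq> set_mset R" "\<And>E'. E' \<in># R \<Longrightarrow> E' \<in> N \<longleftrightarrow> E \<noteq> E' \<and> E \<inter> E' \<noteq> {}" for E N
    using that by blast
  show False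
  proof (rule has_type_no_null_weight[OF R])
    show "R \<noteq> {#}" using assms by auto
    show "m E > 0" for E by (simp add: m_def)
    have N: "{E'. E' \<in># R \<and> C \<noteq> E' \<and> C \<inter> E' \<noteq> {}} = {S 1, M 1, L 1}"
      "{E'. E' \<in># R \<and> S 1 \<noteq> E' \<and> S 1 \<inter> E' \<noteq> {}} = {C}"
      "{E'. E' \<in># R \<and> M 1 \<noteq> E' \<and> M 1 \<inter> E' \<noteq> {}} = {C, M 2}"
      "{E'. E' \<in># R \<and> M 2 \<noteq> E' \<and> M 2 \<inter> E' \<noteq> {}} = {M 1, M 3}"
      "{E'. E' \<in># R \<and> M 3 \<noteq> E' \<and> M 3 \<inter> E' \<noteq> {}} = {M 2}"
      "{E'. E' \<in># R \<and> L 1 \<noteq> E' \<and> L 1 \<inter> E' \<noteq> {}} = {C, L 2}"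
      "{E'. E' \<in># R \<and> L 2 \<noteq> E' \<and> L 2 \<inter> E' \<noteq> {}} = {L 1, L 3}"
      "{E'. E' \<in># R \<and> L 3 \<noteq> E' \<and> L 3 \<inter> E' \<noteq> {}} = {L 2}"
      by (rule neighbours; (unfold assms)?; (elim insertE emptyE)?;
          simp add: disjoint_iff_no_edge doubleton_eq_iff)+
    show "2 * m E = (\<Sum>E' | E' \<in># R \<and> E \<noteq> E' \<and> E \<inter> E' \<noteq> {}. m E')" if "E \<in># R" for E
    proof -
      have "E \<in> components" using that assms by simp
      then show ?thesis
        by (elim insertE emptyE; simp only: N; simp add: m_def)
    qed
  qed
qed

section \<open>Tails and their separation from the central divisor\<close>

text \<open>Beyond the gap a branch keeps at most two curves, \<open>M 2\<close> and
  \<open>M 3\<close>, and every nonempty subset of these is a single subchain from \<open>p\<close>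
  to \<open>q\<close>. So one summand suffices, and its length \<open>q + 1 - p\<close> is at most
  \<open>2 - \<beta>\<close> because \<open>\<beta> + 2 \<le> p\<close> and
  \<open>q \<le> 3\<close>.\<close>

lemma tail_conditionI:
  assumes "reduced_divisor T" "set_mset T \<subseteq> M ` {\<beta> + 2..3}"
  shows "tail_condition M \<beta> T"
proof -
  have chain: "tail_condition M \<beta> T"
    if T: "set_mset T = M ` {p..q}" and pq: "\<beta> + 2 \<le> p" "p \<le> q" "q \<le> 3" for p q
  proof -
    let ?xs = "map M [p..<q + 1]"
    have "(p, q) \<in> {(2, 2), (2, 3), (3, 3)}" using pq by auto
    then have xs: "curve_chain ?xs"
      by (elim insertE emptyE; simp add: upt_rec disjoint_iff_no_edge doubleton_eq_iff)
    have "set ?xs = M ` {p..q}" by auto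
    then have T_eq: "T = mset ?xs"
      using assms(1) T xs
      by (intro reduced_divisor_eqI)
        (simp_all only: reduced_divisor_mset curve_chain_distinct set_mset_mset)
    have "union_of_subchains M (\<beta> + 2) 3 T"
      unfolding union_of_subchains_def T_eq using pq
      by (intro exI[of _ "[(p, q)]"]) (simp add: sum_singletons_eq_mset)
    moreover have "has_type T {#DynA (q + 1 - p)#}"
      using has_type_chain[OF xs, of T] pq T_eq by simp
    ultimately show ?thesis
      unfolding tail_condition_def using pq by (auto intro!: exI[of _ "[q + 1 - p]"])
  qed
  have "{0 + 2..3::nat} = {2, 3}" "{1 + 2..3::nat} = {3}" by auto
  then have "M ` {\<beta> + 2..3} = (if \<beta> = 0 then {M 2, M 3} else if \<beta> = 1 then {M 3} else {})"
    by simp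
  then have sub: "set_mset T \<subseteq> (if \<beta> = 0 then {M 2, M 3} else if \<beta> = 1 then {M 3} else {})"
    using assms(2) by simp
  have two: "A = {} \<or> A = {x} \<or> A = {y} \<or> A = {x, y}" if "A \<subseteq> {x, y}" for A and x y :: "'p set"
    using that by blast
  have "set_mset T = {} \<or> set_mset T = {M 2} \<and> \<beta> = 0 \<or> set_mset T = {M 3} \<and> \<beta> \<le> 1 \<or>
      set_mset T = {M 2, M 3} \<and> \<beta> = 0"
    using sub two[of "set_mset T" "M 2" "M 3"]
    by (cases "\<beta> = 0"; cases "\<beta> = 1"; simp add: subset_singleton_iff)
  then consider "set_mset T = {}" | "set_mset T = {M 2}" "\<beta> = 0" | "set_mset T = {M 3}" "\<beta> \<le> 1"
    | "set_mset T = {M 2, M 3}" "\<beta> = 0"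
    by blast
  then show ?thesis
  proof cases
    case 1
    then show ?thesis by (simp add: tail_condition_def)
  qed (use chain[of 2 2] chain[of 3 3] chain[of 2 3] in \<open>simp_all add: small_intervals\<close>)
qed

lemma tail_components:
  "set_mset T \<subseteq> M ` {\<beta> + 2..3} \<Longrightarrow>
     E \<in># T \<Longrightarrow> E = M 2 \<and> \<beta> = 0 \<or> E = M 3 \<and> \<beta> \<le> 1"
proof -
  assume "set_mset T \<subseteq> M ` {\<beta> + 2..3}" "E \<in># T"
  then obtain j where "E = M j" "\<beta> + 2 \<le> j" "j \<le> 3" by auto
  moreover from this have "j = 2 \<or> j = 3" by linarith
  ultimately show ?thesis by auto
qed

lemma tail_disjoint_central:
  assumes "\<alpha> \<le> 1" "\<beta> \<le> 3" "\<gamma> \<le> 3" "set_mset T \<subseteq> M ` {\<beta> + 2..3}"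
    and E: "E \<in># central \<alpha> \<beta> \<gamma>" and E': "E' \<in># T"
  shows "E \<inter> E' = {}"
proof -
  have "\<forall>E\<in>components. E \<in># central \<alpha> \<beta> \<gamma> \<longrightarrow> E \<inter> M 3 = {}" if "\<beta> \<le> 1"
    using that by (simp add: member_central[OF assms(1-3)] disjoint_iff_no_edge doubleton_eq_iff)
  moreover have "\<forall>E\<in>components. E \<in># central \<alpha> \<beta> \<gamma> \<longrightarrow> E \<inter> M 2 = {}" if "\<beta> = 0"
    using that member_central[OF assms(1-3)] by (simp add: disjoint_iff_no_edge doubleton_eq_iff)
  moreover have "E \<in> components"
    using central_subset[OF assms(1-3)] E by (rule subsetD)
  ultimately show ?thesis
    using E tail_components[OF assms(4) E'] by metis
qed

section \<open>The connected component of the central curve\<close>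

text \<open>The arm lengths count the curves of \<open>R\<close> on each branch before the first
  gap. Walking outwards from \<open>C\<close> reaches all of them, and the set so obtained is closed
  under the edges of the dual graph of \<open>R\<close>, so nothing else is reached. The last three
  conclusions record the gaps.\<close>

lemma connected_component_central:
  assumes R: "set_mset R \<subseteq> components" "C \<in># R" "reduced_divisor R"
  obtains \<alpha> \<beta> \<gamma> where "\<alpha> \<le> 1" "\<beta> \<le> 3" "\<gamma> \<le> 3"
    "connected_component_of_divisor R C = central \<alpha> \<beta> \<gamma>"
    "\<alpha> = 0 \<Longrightarrow> S 1 \<notin># R" "\<beta> < 3 \<Longrightarrow> M (\<beta> + 1) \<notin># R" "\<gamma> < 3 \<Longrightarrow> L (\<gamma> + 1) \<notin># R"
proof -
  let ?r = "{(u, v). {u, v} \<in> snd (dual_graph R)}"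
  have segment: "\<exists>n\<le>3. (1 \<le> n \<longrightarrow> f 1 \<in># R) \<and> (2 \<le> n \<longrightarrow> f 2 \<in># R) \<and> (3 \<le> n \<longrightarrow> f 3 \<in># R) \<and>
      (n < 3 \<longrightarrow> f (n + 1) \<notin># R) \<and> (f 1 \<in># R \<longrightarrow> 1 \<le> n) \<and>
      (1 \<le> n \<longrightarrow> f 2 \<in># R \<longrightarrow> 2 \<le> n) \<and> (2 \<le> n \<longrightarrow> f 3 \<in># R \<longrightarrow> 3 \<le> n)" for f :: "nat \<Rightarrow> 'p set"
  proof -
    define n :: nat where
      "n = (if f 1 \<notin># R then 0 else if f 2 \<notin># R then 1 else if f 3 \<notin># R then 2 else 3)"
    show ?thesis by (rule exI[of _ n]) (simp add: n_def)
  qed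
  obtain \<beta> where \<beta>: "\<beta> \<le> 3" "1 \<le> \<beta> \<longrightarrow> M 1 \<in># R" "2 \<le> \<beta> \<longrightarrow> M 2 \<in># R" "3 \<le> \<beta> \<longrightarrow> M 3 \<in># R"
    "\<beta> < 3 \<longrightarrow> M (\<beta> + 1) \<notin># R" "M 1 \<in># R \<longrightarrow> 1 \<le> \<beta>"
    "1 \<le> \<beta> \<longrightarrow> M 2 \<in># R \<longrightarrow> 2 \<le> \<beta>" "2 \<le> \<beta> \<longrightarrow> M 3 \<in># R \<longrightarrow> 3 \<le> \<beta>"
    using segment[of M] by metis
  obtain \<gamma> where \<gamma>: "\<gamma> \<le> 3" "1 \<le> \<gamma> \<longrightarrow> L 1 \<in># R" "2 \<le> \<gamma> \<longrightarrow> L 2 \<in># R" "3 \<le> \<gamma> \<longrightarrow> L 3 \<in># R"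
    "\<gamma> < 3 \<longrightarrow> L (\<gamma> + 1) \<notin># R" "L 1 \<in># R \<longrightarrow> 1 \<le> \<gamma>"
    "1 \<le> \<gamma> \<longrightarrow> L 2 \<in># R \<longrightarrow> 2 \<le> \<gamma>" "2 \<le> \<gamma> \<longrightarrow> L 3 \<in># R \<longrightarrow> 3 \<le> \<gamma>"
    using segment[of L] by metis
  define \<alpha> :: nat where "\<alpha> = (if S 1 \<in># R then 1 else 0)"
  have \<alpha>: "\<alpha> \<le> 1" "1 \<le> \<alpha> \<longleftrightarrow> S 1 \<in># R" by (simp_all add: \<alpha>_def)
  note member = member_central[OF \<alpha>(1) \<beta>(1) \<gamma>(1)]
  have step: "(C, v) \<in> ?r\<^sup>*"
    if "(C, u) \<in> ?r\<^sup>*" "u \<in># R" "v \<in># R" "u \<noteq> v" "u \<inter> v \<noteq> {}" for u v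
    using that by (auto intro: rtrancl_into_rtrancl simp: dual_graph_edge)
  have "(C, E) \<in> ?r\<^sup>* \<and> E \<in># R" if "E \<in># central \<alpha> \<beta> \<gamma>" for E
  proof -
    have S1: "(C, S 1) \<in> ?r\<^sup>*" if "1 \<le> \<alpha>"
      using step[of C "S 1"] that \<alpha> R(2) by (simp add: disjoint_iff_no_edge)
    have M1: "(C, M 1) \<in> ?r\<^sup>*" if "1 \<le> \<beta>"
      using step[of C "M 1"] that \<beta>(2-4) R(2) by (simp add: disjoint_iff_no_edge)
    have M2: "(C, M 2) \<in> ?r\<^sup>*" if "2 \<le> \<beta>"
      using step[of "M 1" "M 2"] M1 that \<beta>(2-4) by (simp add: disjoint_iff_no_edge)
    have M3: "(C, M 3) \<in> ?r\<^sup>*" if "3 \<le> \<beta>"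
      using step[of "M 2" "M 3"] M2 that \<beta>(2-4) by (simp add: disjoint_iff_no_edge)
    have L1: "(C, L 1) \<in> ?r\<^sup>*" if "1 \<le> \<gamma>"
      using step[of C "L 1"] that \<gamma>(2-4) R(2) by (simp add: disjoint_iff_no_edge)
    have L2: "(C, L 2) \<in> ?r\<^sup>*" if "2 \<le> \<gamma>"
      using step[of "L 1" "L 2"] L1 that \<gamma>(2-4) by (simp add: disjoint_iff_no_edge)
    have L3: "(C, L 3) \<in> ?r\<^sup>*" if "3 \<le> \<gamma>"
      using step[of "L 2" "L 3"] L2 that \<gamma>(2-4) by (simp add: disjoint_iff_no_edge)
    have "\<forall>E\<in>components. E \<in># central \<alpha> \<beta> \<gamma> \<longrightarrow> (C, E) \<in> ?r\<^sup>* \<and> E \<in># R"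
      using S1 M1 M2 M3 L1 L2 L3 \<alpha>(2) \<beta>(2-4) \<gamma>(2-4) R(2) by (simp add: member)
    moreover have "E \<in> components"
      using central_subset[OF \<alpha>(1) \<beta>(1) \<gamma>(1)] that by (rule subsetD)
    ultimately show ?thesis using that by metis
  qed
  moreover have "E \<in># central \<alpha> \<beta> \<gamma>" if "(C, E) \<in> ?r\<^sup>*" for E
    using that
  proof (induction rule: rtrancl_induct)
    case base
    then show ?case by (rule member)
  next
    case (step y z)
    let ?\<Gamma> = "central \<alpha> \<beta> \<gamma>"
    \<comment> \<open>One closure fact for each direction of an edge. A step from \<open>M 3\<close>
      or \<open>L 3\<close> back towards \<open>C\<close> needs its own fact, because membership of
      \<open>M 2\<close> or \<open>L 2\<close> in \<open>R\<close> alone does not put it into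
      \<Gamma>.\<close>
    have stop: "C \<in># ?\<Gamma>" "S 1 \<in># R \<Longrightarrow> S 1 \<in># ?\<Gamma>" "M 1 \<in># R \<Longrightarrow> M 1 \<in># ?\<Gamma>"
      "M 1 \<in># ?\<Gamma> \<Longrightarrow> M 2 \<in># R \<Longrightarrow> M 2 \<in># ?\<Gamma>"
      "M 2 \<in># ?\<Gamma> \<Longrightarrow> M 3 \<in># R \<Longrightarrow> M 3 \<in># ?\<Gamma>" "M 3 \<in># ?\<Gamma> \<Longrightarrow> M 2 \<in># ?\<Gamma>"
      "L 1 \<in># R \<Longrightarrow> L 1 \<in># ?\<Gamma>" "L 1 \<in># ?\<Gamma> \<Longrightarrow> L 2 \<in># R \<Longrightarrow> L 2 \<in># ?\<Gamma>"
      "L 2 \<in># ?\<Gamma> \<Longrightarrow> L 3 \<in># R \<Longrightarrow> L 3 \<in># ?\<Gamma>" "L 3 \<in># ?\<Gamma> \<Longrightarrow> L 2 \<in># ?\<Gamma>"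
      using \<alpha>(2) \<beta>(6-8) \<gamma>(6-8) by (simp_all add: member)
    have yz: "z \<in># R" "y \<in> components" "z \<in> components" "y \<noteq> z" "y \<inter> z \<noteq> {}"
      using step.hyps(2) R(1) unfolding mem_Collect_eq prod.case dual_graph_edge
      by (meson subsetD)+
    have "{y, z} \<in>
        {{C, S 1}, {C, M 1}, {M 1, M 2}, {M 2, M 3}, {C, L 1}, {L 1, L 2}, {L 2, L 3}}"
      using meet[OF yz(2-4)] yz(5) by (rule iffD1)
    then show ?case
      unfolding insert_iff empty_iff doubleton_eq_iff using step.IH yz(1)
      by (elim disjE conjE FalseE; simp only: stop)
  qed
  ultimately have
    "set_mset (connected_component_of_divisor R C) = set_mset (central \<alpha> \<beta> \<gamma>)"
    unfolding connected_component_of_divisor_def by auto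
  moreover have "reduced_divisor (connected_component_of_divisor R C)"
    unfolding connected_component_of_divisor_def
    by (rule reduced_divisor_mono[OF multiset_filter_subset R(3)])
  ultimately have "connected_component_of_divisor R C = central \<alpha> \<beta> \<gamma>"
    using reduced_central[OF \<alpha>(1) \<beta>(1) \<gamma>(1)] by (intro reduced_divisor_eqI)
  then show thesis
    by (rule that[OF \<alpha>(1) \<beta>(1) \<gamma>(1)]) (use \<alpha>(2) \<beta>(5) \<gamma>(5) in simp_all)
qed

section \<open>Existence of a type for central divisors with tails\<close>

lemma central_has_type:
  assumes "\<alpha> \<le> 1" "\<beta> \<le> 3" "\<gamma> \<le> 3" "\<not> (\<alpha> \<noteq> 0 \<and> \<beta> = 3 \<and> \<gamma> = 3)"
  shows "\<exists>T. has_type (central \<alpha> \<beta> \<gamma>) T"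
proof (cases "\<alpha> \<noteq> 0 \<and> \<beta> \<noteq> 0 \<and> \<gamma> \<noteq> 0")
  case True
  then have "\<alpha> = 1" "min \<beta> \<gamma> = 1 \<or> min \<beta> \<gamma> = 2" using assms by auto
  then show ?thesis
    using central_type_DE[OF assms(2,3) _ _ refl refl] True by blast
next
  case False
  then show ?thesis using central_type_A assms by blast
qed

lemma tail_has_type: "tail_condition N \<beta> T \<Longrightarrow> \<exists>t. has_type T t"
  unfolding tail_condition_def using has_type_empty by blast

text \<open>The gaps separate \<Gamma> from both tails, and curves of different branches do not
  meet, so the three types add. Reducedness provides the distinctness of curves that
  \<open>has_type_add\<close> requires.\<close>

lemma central_with_tails_has_type:
  assumes bounds: "\<alpha> \<le> 1" "\<beta> \<le> 3" "\<gamma> \<le> 3" "\<not> (\<alpha> \<noteq> 0 \<and> \<beta> = 3 \<and> \<gamma> = 3)"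
    and tails: "tail_condition M \<beta> R\<^sub>M" "tail_condition L \<gamma> R\<^sub>L"
    and reduced: "reduced_divisor (central \<alpha> \<beta> \<gamma> + R\<^sub>M + R\<^sub>L)"
  shows "\<exists>T. has_type (central \<alpha> \<beta> \<gamma> + R\<^sub>M + R\<^sub>L) T"
proof -
  interpret swap: E7_tilde_configuration C S L M by (rule swap)
  obtain T T\<^sub>M T\<^sub>L where T: "has_type (central \<alpha> \<beta> \<gamma>) T" "has_type R\<^sub>M T\<^sub>M" "has_type R\<^sub>L T\<^sub>L"
    using central_has_type[OF bounds] tail_has_type tails by meson
  note sets = tails[THEN set_tail]
  note disjoint = reduced_divisor_add_disjoint[OF reduced]
    reduced_divisor_add_disjoint[OF reduced_divisor_add[OF reduced, THEN conjunct1]]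
  have first: "has_type (central \<alpha> \<beta> \<gamma> + R\<^sub>M) (T + T\<^sub>M)"
    using T(1,2) disjoint(2) tail_disjoint_central[OF bounds(1-3) sets(1)] by (rule has_type_add)
  have "x \<inter> y = {}" if "x \<in># central \<alpha> \<beta> \<gamma> + R\<^sub>M" "y \<in># R\<^sub>L" for x y
  proof (cases "x \<in># R\<^sub>M")
    case True
    have "x = M 2 \<or> x = M 3" "y = L 2 \<or> y = L 3"
      using tail_components[OF sets(1) True] swap.tail_components[OF sets(2) that(2)] by blast+
    then show ?thesis by (elim disjE; simp add: disjoint_iff_no_edge doubleton_eq_iff)
  next
    case False
    then have "x \<in># swap.central \<alpha> \<gamma> \<beta>"
      using that(1) by (simp add: central_divisor_swap[of C S L M])
    then show ?thesis
      using swap.tail_disjoint_central bounds sets(2) that(2) by blast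
  qed
  with first T(3) disjoint(1)
  have "has_type (central \<alpha> \<beta> \<gamma> + R\<^sub>M + R\<^sub>L) (T + T\<^sub>M + T\<^sub>L)"
    by (rule has_type_add)
  then show ?thesis ..
qed

section \<open>The interchange of the two long branches\<close>

text \<open>The three transpositions act on disjoint pairs of curves. The index bounds matter, since
  the other values of \<open>M\<close> and \<open>L\<close> are arbitrary.\<close>

lemma interchange_curves:
  defines "\<tau> \<equiv> Transposition.transpose (M 1) (L 1) \<circ> Transposition.transpose (M 2) (L 2) \<circ>
                 Transposition.transpose (M 3) (L 3)"
  shows "inj \<tau>" "\<tau> C = C" "\<tau> (S 1) = S 1"
    "\<And>i. 1 \<le> i \<Longrightarrow> i \<le> 3 \<Longrightarrow> \<tau> (M i) = L i" "\<And>i. 1 \<le> i \<Longrightarrow> i \<le> 3 \<Longrightarrow> \<tau> (L i) = M i"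
proof -
  show "inj \<tau>" unfolding \<tau>_def by (intro inj_compose) simp_all
  show "\<tau> C = C" "\<tau> (S 1) = S 1" by (simp_all add: \<tau>_def)
  fix i :: nat
  assume "1 \<le> i" "i \<le> 3"
  then have "i = 1 \<or> i = 2 \<or> i = 3" by linarith
  then show "\<tau> (M i) = L i" "\<tau> (L i) = M i"
    by (elim disjE; simp add: \<tau>_def)+
qed

text \<open>The lengths keep their positions while the names move: the image has an L-arm of length
  \<beta> and an M-arm of length \<gamma>, which is a central divisor of the swapped configuration
  with the same triple.\<close>

lemma interchange_central:
  assumes "\<alpha> \<le> 1" "\<beta> \<le> 3" "\<gamma> \<le> 3"
  shows "interchange_branches M L (central \<alpha> \<beta> \<gamma>) = central_divisor C S L M \<alpha> \<beta> \<gamma>"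
proof -
  define \<tau> where "\<tau> = Transposition.transpose (M 1) (L 1) \<circ> Transposition.transpose (M 2) (L 2) \<circ>
                 Transposition.transpose (M 3) (L 3)"
  note \<tau> = interchange_curves[folded \<tau>_def]
  have "\<alpha> = 0 \<or> \<alpha> = 1" using assms by linarith
  then have "map \<tau> (map S [1..<\<alpha> + 1]) = map S [1..<\<alpha> + 1]"
    by (elim disjE; simp only: small_upt; simp add: \<tau>)
  moreover have "map \<tau> (map M [1..<\<beta> + 1]) = map L [1..<\<beta> + 1]"
    "map \<tau> (map L [1..<\<gamma> + 1]) = map M [1..<\<gamma> + 1]"
    using assms \<tau> by simp_all
  ultimately show ?thesis
    unfolding interchange_branches_def \<tau>_def[symmetric] central_divisor_eq_mset mset_map[symmetric]
    by (simp only: list.map map_append \<tau>(2))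
qed

lemma set_interchange_tail:
  assumes "set_mset T \<subseteq> M ` {\<beta> + 2..3}"
  shows "set_mset (interchange_branches M L T) \<subseteq> L ` {\<beta> + 2..3}"
  using assms interchange_curves(4) unfolding interchange_branches_def
  by (force simp del: o_apply)

lemma interchange_branches_swap: "interchange_branches M L = interchange_branches L M"
  unfolding interchange_branches_def by (simp only: transpose_commute)

lemma reduced_interchange:
  assumes "reduced_divisor T"
  shows "reduced_divisor (interchange_branches M L T)"
proof -
  obtain xs where "T = mset xs" using ex_mset by metis
  then show ?thesis
    using assms inj_on_subset[OF interchange_curves(1) subset_UNIV]
    unfolding interchange_branches_def
    by (simp add: reduced_divisor_mset distinct_map del: mset_map flip: mset_map)
qed

lemma set_interchange:
  assumes "set_mset T \<subseteq> components"
  shows "set_mset (interchange_branches M L T) \<subseteq> components"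
proof -
  define \<tau> where "\<tau> = Transposition.transpose (M 1) (L 1) \<circ> Transposition.transpose (M 2) (L 2) \<circ>
                 Transposition.transpose (M 3) (L 3)"
  note \<tau> = interchange_curves[folded \<tau>_def]
  have "\<tau> ` components \<subseteq> components"
    using \<tau> by simp
  then show ?thesis
    unfolding interchange_branches_def \<tau>_def[symmetric] set_image_mset
    by (rule order_trans[OF image_mono[OF assms]])
qed

text \<open>The image again consists of a central divisor and two tails, now in the swapped
  configuration. The tail conditions are not transported: they are rebuilt from reducedness and the
  supports by \<open>tail_conditionI\<close>.\<close>

lemma interchanged_has_type:
  assumes bounds: "\<alpha> \<le> 1" "\<beta> \<le> 3" "\<gamma> \<le> 3" "\<not> (\<alpha> \<noteq> 0 \<and> \<beta> = 3 \<and> \<gamma> = 3)"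
    and tails: "tail_condition M \<beta> R\<^sub>M" "tail_condition L \<gamma> R\<^sub>L"
    and reduced: "reduced_divisor (central \<alpha> \<beta> \<gamma> + R\<^sub>M + R\<^sub>L)"
  shows "\<exists>T. has_type (interchange_branches M L (central \<alpha> \<beta> \<gamma> + R\<^sub>M + R\<^sub>L)) T"
proof -
  interpret swap: E7_tilde_configuration C S L M by (rule swap)
  let ?\<iota> = "interchange_branches M L"
  have \<iota>: "?\<iota> (central \<alpha> \<beta> \<gamma> + R\<^sub>M + R\<^sub>L) = swap.central \<alpha> \<beta> \<gamma> + ?\<iota> R\<^sub>M + ?\<iota> R\<^sub>L"
    using interchange_central[OF bounds(1-3)] by (simp add: interchange_branches_def)
  have "reduced_divisor R\<^sub>M" "reduced_divisor R\<^sub>L"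
    using reduced reduced_divisor_add by blast+
  note reduced_tails = this[THEN reduced_interchange]
  have "tail_condition L \<beta> (?\<iota> R\<^sub>M)"
    using reduced_tails(1) set_interchange_tail[OF set_tail[OF tails(1)]]
    by (rule swap.tail_conditionI)
  moreover have "tail_condition M \<gamma> (?\<iota> R\<^sub>L)"
    using reduced_tails(2)
      swap.set_interchange_tail[OF set_tail[OF tails(2)], folded interchange_branches_swap]
    by (rule tail_conditionI)
  ultimately show ?thesis
    using swap.central_with_tails_has_type bounds reduced_interchange[OF reduced] unfolding \<iota> by blast
qed

section \<open>Decomposition of an ADER into the component and its tails\<close>

text \<open>The gaps are known for the triple constructed in
  \<open>connected_component_central\<close>, while the theorem speaks of any triple representing
  \<Gamma>; \<open>central_inject\<close> identifies the two.\<close>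

lemma component_boundary:
  assumes R: "set_mset R \<subseteq> components" "C \<in># R" "reduced_divisor R"
    and bounds: "\<alpha> \<le> 1" "\<beta> \<le> 3" "\<gamma> \<le> 3"
    and \<Gamma>: "connected_component_of_divisor R C = central \<alpha> \<beta> \<gamma>"
  shows "\<alpha> = 0 \<Longrightarrow> S 1 \<notin># R" "\<beta> < 3 \<Longrightarrow> M (\<beta> + 1) \<notin># R" "\<gamma> < 3 \<Longrightarrow> L (\<gamma> + 1) \<notin># R"
proof -
  obtain \<alpha>' \<beta>' \<gamma>' where *: "\<alpha>' \<le> 1" "\<beta>' \<le> 3" "\<gamma>' \<le> 3"
    "connected_component_of_divisor R C = central \<alpha>' \<beta>' \<gamma>'"
    "\<alpha>' = 0 \<Longrightarrow> S 1 \<notin># R" "\<beta>' < 3 \<Longrightarrow> M (\<beta>' + 1) \<notin># R" "\<gamma>' < 3 \<Longrightarrow> L (\<gamma>' + 1) \<notin># R"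
    using connected_component_central[OF R] by blast
  have "\<alpha> = \<alpha>' \<and> \<beta> = \<beta>' \<and> \<gamma> = \<gamma>'"
    using central_inject[OF bounds *(1-3)] \<Gamma> *(4) by simp
  with * show "\<alpha> = 0 \<Longrightarrow> S 1 \<notin># R" "\<beta> < 3 \<Longrightarrow> M (\<beta> + 1) \<notin># R" "\<gamma> < 3 \<Longrightarrow> L (\<gamma> + 1) \<notin># R"
    by blast+
qed

lemma component_subset: "connected_component_of_divisor R E \<subseteq># R"
  unfolding connected_component_of_divisor_def by (rule multiset_filter_subset)

lemma reduced_diff_not_member:
  assumes "reduced_divisor R" "E \<in># R - \<Gamma>"
  shows "E \<notin># \<Gamma>"
proof -
  have "count \<Gamma> E < count R E" using assms(2) by (rule in_diff_count[THEN iffD1])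
  moreover have "count R E \<le> 1" using assms(1) by (simp add: reduced_divisor_def)
  ultimately show ?thesis by (simp add: count_eq_zero_iff[symmetric])
qed

lemma component_tail:
  assumes R: "set_mset R \<subseteq> components" "C \<in># R" "reduced_divisor R"
    and bounds: "\<alpha> \<le> 1" "\<beta> \<le> 3" "\<gamma> \<le> 3"
    and \<Gamma>: "connected_component_of_divisor R C = central \<alpha> \<beta> \<gamma>"
  shows "tail_condition M \<beta> {#E \<in># R - central \<alpha> \<beta> \<gamma>. E \<in> M ` {1..3}#}"
proof (rule tail_conditionI)
  show "reduced_divisor {#E \<in># R - central \<alpha> \<beta> \<gamma>. E \<in> M ` {1..3}#}"
    using R(3)
    by (rule reduced_divisor_mono[rotated])
      (meson diff_subset_eq_self multiset_filter_subset subset_mset.order_trans)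
  show "set_mset {#E \<in># R - central \<alpha> \<beta> \<gamma>. E \<in> M ` {1..3}#} \<subseteq> M ` {\<beta> + 2..3}"
  proof
    fix E
    assume "E \<in># {#E \<in># R - central \<alpha> \<beta> \<gamma>. E \<in> M ` {1..3}#}"
    then have "E \<in># R - central \<alpha> \<beta> \<gamma>" "E \<in> M ` {1..3}"
      by (simp_all only: set_mset_filter mem_Collect_eq)
    then obtain i where E: "M i \<in># R - central \<alpha> \<beta> \<gamma>" "E = M i" "1 \<le> i" "i \<le> 3"
      by (elim imageE) simp
    have "M i \<notin># central \<alpha> \<beta> \<gamma>" using R(3) E(1) by (rule reduced_diff_not_member)
    then have "\<not> i \<le> \<beta>" using E(3) by (auto simp: set_central_divisor)
    \<comment> \<open>Here \<open>i \<le> 3\<close> turns the equation into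
      \<open>\<beta> < 3\<close>, the range in which the branch has a next curve.\<close>
    moreover have "M (\<beta> + 1) \<notin># R" if "i = \<beta> + 1"
      by (rule component_boundary(2)[OF R bounds \<Gamma>]) (use that E(4) in linarith)
    then have "i \<noteq> \<beta> + 1"
      using in_diffD[OF E(1)] by blast
    ultimately have "i \<in> {\<beta> + 2..3}" using E(4) by simp
    then show "E \<in> M ` {\<beta> + 2..3}" unfolding E(2) by (rule imageI)
  qed
qed

text \<open>Outside \<Gamma> neither \<open>C\<close> nor \<open>S 1\<close> is left:
  \<open>C\<close> always lies in \<Gamma>, and \<open>S 1\<close> lies in \<Gamma> unless
  \<open>\<alpha> = 0\<close>, when it is not in \<open>R\<close>. The rest is split by
  branch.\<close>

lemma component_decomposition:
  assumes R: "set_mset R \<subseteq> components" "C \<in># R" "reduced_divisor R"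
    and bounds: "\<alpha> \<le> 1" "\<beta> \<le> 3" "\<gamma> \<le> 3"
    and \<Gamma>: "connected_component_of_divisor R C = central \<alpha> \<beta> \<gamma>"
  shows "R = central \<alpha> \<beta> \<gamma> + {#E \<in># R - central \<alpha> \<beta> \<gamma>. E \<in> M ` {1..3}#} +
      {#E \<in># R - central \<alpha> \<beta> \<gamma>. E \<in> L ` {1..3}#}"
proof -
  let ?D = "R - central \<alpha> \<beta> \<gamma>"
  have "E \<notin> M ` {1..3} \<longleftrightarrow> E \<in> L ` {1..3}" if "E \<in># ?D" for E
  proof -
    have "E \<notin># central \<alpha> \<beta> \<gamma>" using R(3) that by (rule reduced_diff_not_member)
    moreover have E: "E \<in># R" using that by (rule in_diffD)
    moreover from this have "E \<in> components" using R(1) by (rule subsetD[rotated])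
    ultimately have "E \<in> {M 1, M 2, M 3, L 1, L 2, L 3}"
      using component_boundary(1)[OF R bounds \<Gamma>] member_central(1,2)[OF bounds]
      by (metis insert_iff less_one not_less)
    then show ?thesis
      by (elim insertE emptyE; simp add: small_intervals)
  qed
  then have tails: "{#E \<in># ?D. E \<notin> M ` {1..3}#} = {#E \<in># ?D. E \<in> L ` {1..3}#}"
    by (intro filter_mset_cong refl)
  have "R = central \<alpha> \<beta> \<gamma> + ?D"
    using component_subset[of R C] \<Gamma> by simp
  also have "?D = {#E \<in># ?D. E \<in> M ` {1..3}#} + {#E \<in># ?D. E \<in> L ` {1..3}#}"
    unfolding tails[symmetric] by (rule multiset_partition)
  finally show ?thesis by (simp only: add.assoc)
qed

text \<open>The contradiction is drawn from the type of \<open>R\<close>, which is given, rather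
  than from \<Gamma>: three full arms already make \<open>R\<close> contain all eight
  curves.\<close>

lemma component_not_everything:
  assumes R: "set_mset R \<subseteq> components" "has_type R T"
    and \<Gamma>: "connected_component_of_divisor R C = central 1 \<beta> \<gamma>" "\<beta> \<le> 3" "\<gamma> \<le> 3"
  shows "min \<beta> \<gamma> \<noteq> 3"
proof
  assume "min \<beta> \<gamma> = 3"
  then have "\<beta> = 3" "\<gamma> = 3" using \<Gamma>(2,3) by auto
  then have "components \<subseteq> set_mset R"
    using set_mset_mono[OF component_subset[of R C]] \<Gamma>(1)
    by (simp add: set_central_divisor small_intervals)
  then show False using has_no_type_if_all_components R by blast
qed

end

section \<open>Both directions for the given fiber\<close>

theorem proposition13p2:
  fixes X B :: "'k::{alg_closed_field, field_char_0} ppoint set"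
    and \<pi> :: "'k ppoint \<Rightarrow> 'k ppoint" and b :: "'k ppoint"
    and F :: "'k ppoint set multiset"
    and C :: "'k ppoint set" and S M L :: "nat \<Rightarrow> 'k ppoint set"
  assumes "K3_surface X"
    and "elliptic_fibration X B \<pi>"
    and "is_fiber X B \<pi> b F"
    and "type_III_star X F C S M L"
  shows
    "(\<forall>R \<Gamma>. ADER F R \<and> C \<in># R \<and> \<Gamma> = connected_component_of_divisor R C \<longrightarrow>
        (\<exists>!(\<alpha>, \<beta>, \<gamma>). \<alpha> \<le> 1 \<and> \<beta> \<le> 3 \<and> \<gamma> \<le> 3 \<and> \<Gamma> = central_divisor C S M L \<alpha> \<beta> \<gamma>) \<and>
        (\<forall>\<alpha> \<beta> \<gamma> R\<^sub>M R\<^sub>L.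
           \<alpha> \<le> 1 \<and> \<beta> \<le> 3 \<and> \<gamma> \<le> 3 \<and> \<Gamma> = central_divisor C S M L \<alpha> \<beta> \<gamma> \<and>
           R\<^sub>M = {#E \<in># R - \<Gamma>. E \<in> M ` {1..3}#} \<and> R\<^sub>L = {#E \<in># R - \<Gamma>. E \<in> L ` {1..3}#} \<longrightarrow>
           R = \<Gamma> + R\<^sub>M + R\<^sub>L \<and>
           ((\<not> (\<alpha> \<noteq> 0 \<and> \<beta> \<noteq> 0 \<and> \<gamma> \<noteq> 0) \<and> has_type \<Gamma> {#DynA (1 + \<alpha> + \<beta> + \<gamma>)#}) \<or>
            (\<alpha> \<noteq> 0 \<and> \<beta> \<noteq> 0 \<and> \<gamma> \<noteq> 0 \<and>
             (\<forall>\<beta>' \<gamma>'. \<beta>' = min \<beta> \<gamma> \<and> \<gamma>' = max \<beta> \<gamma> \<longrightarrow>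
                (\<beta>', \<gamma>') \<noteq> (3, 3) \<and>
                (\<beta>' = 1 \<longrightarrow> has_type \<Gamma> {#DynD (\<gamma>' + 3)#}) \<and>
                ((\<beta>', \<gamma>') = (2, 2) \<longrightarrow> has_type \<Gamma> {#DynE 6#}) \<and>
                ((\<beta>', \<gamma>') = (2, 3) \<longrightarrow> has_type \<Gamma> {#DynE 7#})))) \<and>
           tail_condition M \<beta> R\<^sub>M \<and> tail_condition L \<gamma> R\<^sub>L)) \<and>
     (\<forall>\<alpha> \<beta> \<gamma> R\<^sub>M R\<^sub>L D.
        \<alpha> \<le> 1 \<and> \<beta> \<le> 3 \<and> \<gamma> \<le> 3 \<and>
        (\<not> (\<alpha> \<noteq> 0 \<and> \<beta> \<noteq> 0 \<and> \<gamma> \<noteq> 0) \<or>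
         (\<alpha> \<noteq> 0 \<and> \<beta> \<noteq> 0 \<and> \<gamma> \<noteq> 0 \<and> \<beta> \<le> \<gamma> \<and> (\<beta>, \<gamma>) \<noteq> (3, 3))) \<and>
        tail_condition M \<beta> R\<^sub>M \<and> tail_condition L \<gamma> R\<^sub>L \<and>
        D = central_divisor C S M L \<alpha> \<beta> \<gamma> + R\<^sub>M + R\<^sub>L \<and>
        D \<subseteq># F \<and> reduced_divisor D \<longrightarrow>
        ADER F D \<and> ADER F (interchange_branches M L D))"
proof -
  have III_star: "distinct [C, S 1, M 1, M 2, M 3, L 1, L 2, L 3]"
    "F = replicate_mset 4 C + replicate_mset 2 (S 1) +
         replicate_mset 3 (M 1) + replicate_mset 2 (M 2) + replicate_mset 1 (M 3) +
         replicate_mset 3 (L 1) + replicate_mset 2 (L 2) + replicate_mset 1 (L 3)"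
    "snd (dual_graph F) =
       {{C, S 1}, {C, M 1}, {M 1, M 2}, {M 2, M 3}, {C, L 1}, {L 1, L 2}, {L 2, L 3}}"
    using assms(4) unfolding type_III_star_def by - (elim conjE, assumption)+
  have set_F: "set_mset F = {C, S 1, M 1, M 2, M 3, L 1, L 2, L 3}"
    unfolding III_star(2) by (simp add: insert_commute)
  interpret E7_tilde_configuration C S M L
  proof
    show "distinct [C, S 1, M 1, M 2, M 3, L 1, L 2, L 3]" by (rule III_star)
    show "E \<inter> E' \<noteq> {} \<longleftrightarrow> {E, E'} \<in>
        {{C, S 1}, {C, M 1}, {M 1, M 2}, {M 2, M 3}, {C, L 1}, {L 1, L 2}, {L 2, L 3}}"
      if "E \<in> {C, S 1, M 1, M 2, M 3, L 1, L 2, L 3}"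
        "E' \<in> {C, S 1, M 1, M 2, M 3, L 1, L 2, L 3}" "E \<noteq> E'" for E E'
      using that unfolding III_star(3)[symmetric] set_F[symmetric] dual_graph_edge by blast
  qed
  interpret swap: E7_tilde_configuration C S L M by (rule swap)
  have set_component: "set_mset R \<subseteq> components" if "R \<subseteq># F" for R
    using set_mset_mono[OF that] unfolding set_F .
  \<comment> \<open>Every component has multiplicity at least 1 in \<open>F\<close>, so a reduced
    divisor is a subdivisor as soon as its support is right. This applies to the interchanged
    divisor as well.\<close>
  have ADER_I: "ADER F R" if "set_mset R \<subseteq> components" "reduced_divisor R" "\<exists>T. has_type R T" for R
  proof -
    have "count R E \<le> count F E" for E
    proof (cases "E \<in># R")
      case True
      then have "E \<in># F" using that(1) unfolding set_F by (rule subsetD[rotated])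
      then have "1 \<le> count F E" by simp
      moreover have "count R E \<le> 1" using that(2) by (simp add: reduced_divisor_def)
      ultimately show ?thesis by linarith
    qed (simp add: not_in_iff)
    then have "R \<subseteq># F" by (rule mset_subset_eqI)
    then show ?thesis using that(2,3) by (simp add: ADER_def)
  qed
  show ?thesis
  proof (intro conjI allI impI; (elim conjE)?)
    fix R \<Gamma>
    assume "ADER F R" and C: "C \<in># R" and \<Gamma>: "\<Gamma> = connected_component_of_divisor R C"
    then obtain T where "R \<subseteq># F" and red: "reduced_divisor R" and T: "has_type R T"
      unfolding ADER_def by blast
    then have R: "set_mset R \<subseteq> components" "C \<in># R" "reduced_divisor R"
      using C set_component by blast+
    obtain \<alpha> \<beta> \<gamma> where obt: "\<alpha> \<le> 1" "\<beta> \<le> 3" "\<gamma> \<le> 3" "\<Gamma> = central \<alpha> \<beta> \<gamma>"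
      using connected_component_central[OF R] \<Gamma> by metis
    show "\<exists>!(\<alpha>, \<beta>, \<gamma>). \<alpha> \<le> 1 \<and> \<beta> \<le> 3 \<and> \<gamma> \<le> 3 \<and> \<Gamma> = central \<alpha> \<beta> \<gamma>"
    proof (rule ex1I[of _ "(\<alpha>, \<beta>, \<gamma>)"])
      show "case (\<alpha>, \<beta>, \<gamma>) of (\<alpha>, \<beta>, \<gamma>) \<Rightarrow>
          \<alpha> \<le> 1 \<and> \<beta> \<le> 3 \<and> \<gamma> \<le> 3 \<and> \<Gamma> = central \<alpha> \<beta> \<gamma>"
        using obt by simp
      fix t
      assume "case t of (\<alpha>, \<beta>, \<gamma>) \<Rightarrow> \<alpha> \<le> 1 \<and> \<beta> \<le> 3 \<and> \<gamma> \<le> 3 \<and> \<Gamma> = central \<alpha> \<beta> \<gamma>"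
      then show "t = (\<alpha>, \<beta>, \<gamma>)"
        using central_inject[OF obt(1-3)] obt(4) by (cases t) auto
    qed
    fix \<alpha> \<beta> \<gamma> :: nat and R\<^sub>M R\<^sub>L
    assume bounds: "\<alpha> \<le> 1" "\<beta> \<le> 3" "\<gamma> \<le> 3" and \<Gamma>': "\<Gamma> = central \<alpha> \<beta> \<gamma>"
      and R\<^sub>M: "R\<^sub>M = {#E \<in># R - \<Gamma>. E \<in> M ` {1..3}#}"
      and R\<^sub>L: "R\<^sub>L = {#E \<in># R - \<Gamma>. E \<in> L ` {1..3}#}"
    have comp: "connected_component_of_divisor R C = central \<alpha> \<beta> \<gamma>"
      using \<Gamma> \<Gamma>' by simp
    have R_swap: "set_mset R \<subseteq> swap.components"
      using R(1) by (simp only: insert_commute)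
    show "R = \<Gamma> + R\<^sub>M + R\<^sub>L"
      unfolding R\<^sub>M R\<^sub>L \<Gamma>' by (rule component_decomposition[OF R bounds comp])
    show "tail_condition M \<beta> R\<^sub>M"
      unfolding R\<^sub>M \<Gamma>' by (rule component_tail[OF R bounds comp])
    \<comment> \<open>The L-tail is the M-tail of the swapped configuration, whose triple has
      \<beta> and \<gamma> exchanged; hence the permuted bounds.\<close>
    show "tail_condition L \<gamma> R\<^sub>L"
      using swap.component_tail[OF R_swap R(2,3) bounds(1,3,2)] comp
      unfolding R\<^sub>L \<Gamma>' central_divisor_swap[of C S L M] by blast
    show "(\<not> (\<alpha> \<noteq> 0 \<and> \<beta> \<noteq> 0 \<and> \<gamma> \<noteq> 0) \<and> has_type \<Gamma> {#DynA (1 + \<alpha> + \<beta> + \<gamma>)#}) \<or>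
        (\<alpha> \<noteq> 0 \<and> \<beta> \<noteq> 0 \<and> \<gamma> \<noteq> 0 \<and>
         (\<forall>\<beta>' \<gamma>'. \<beta>' = min \<beta> \<gamma> \<and> \<gamma>' = max \<beta> \<gamma> \<longrightarrow>
            (\<beta>', \<gamma>') \<noteq> (3, 3) \<and>
            (\<beta>' = 1 \<longrightarrow> has_type \<Gamma> {#DynD (\<gamma>' + 3)#}) \<and>
            ((\<beta>', \<gamma>') = (2, 2) \<longrightarrow> has_type \<Gamma> {#DynE 6#}) \<and>
            ((\<beta>', \<gamma>') = (2, 3) \<longrightarrow> has_type \<Gamma> {#DynE 7#})))"
    proof (cases "\<alpha> \<noteq> 0 \<and> \<beta> \<noteq> 0 \<and> \<gamma> \<noteq> 0")
      case True
      then have "\<alpha> = 1" using bounds by simp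
      then have "min \<beta> \<gamma> \<noteq> 3" and \<Gamma>_1: "\<Gamma> = central 1 \<beta> \<gamma>"
        using component_not_everything[OF R(1) T _ bounds(2,3)] comp \<Gamma>' by simp_all
      moreover have "has_type \<Gamma> {#DynD (max \<beta> \<gamma> + 3)#}" if "min \<beta> \<gamma> = 1"
        using central_type_DE(1)[OF bounds(2,3) _ _ refl refl that] True \<Gamma>_1 by simp
      \<comment> \<open>The instances \<open>m = 2\<close> and \<open>m = 3\<close> are E6 and
        E7.\<close>
      moreover have "has_type \<Gamma> {#DynE (m + 4)#}" if "min \<beta> \<gamma> = 2" "max \<beta> \<gamma> = m" for m
        using central_type_DE(2)[OF bounds(2,3) _ _ refl refl that(1)] True \<Gamma>_1 that(2) by simp
      note this[of 2] this[of 3]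
      ultimately show ?thesis using True by simp
    next
      case False
      then show ?thesis using central_type_A[OF bounds] \<Gamma>' by blast
    qed
  next
    fix \<alpha> \<beta> \<gamma> :: nat and R\<^sub>M R\<^sub>L D
    assume bounds: "\<alpha> \<le> 1" "\<beta> \<le> 3" "\<gamma> \<le> 3"
      and cases: "\<not> (\<alpha> \<noteq> 0 \<and> \<beta> \<noteq> 0 \<and> \<gamma> \<noteq> 0) \<or>
         (\<alpha> \<noteq> 0 \<and> \<beta> \<noteq> 0 \<and> \<gamma> \<noteq> 0 \<and> \<beta> \<le> \<gamma> \<and> (\<beta>, \<gamma>) \<noteq> (3, 3))"
      and tails: "tail_condition M \<beta> R\<^sub>M" "tail_condition L \<gamma> R\<^sub>L"
      and D: "D = central \<alpha> \<beta> \<gamma> + R\<^sub>M + R\<^sub>L" "D \<subseteq># F" "reduced_divisor D"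
    \<comment> \<open>What the two alternatives have in common is that \<Gamma> is not the sum of
      all eight components, the one central divisor without a Dynkin type.\<close>
    have adm: "\<not> (\<alpha> \<noteq> 0 \<and> \<beta> = 3 \<and> \<gamma> = 3)" using cases by auto
    note set_D = set_component[OF D(2)]
    show "ADER F D"
      using central_with_tails_has_type[OF bounds adm tails] set_D D(1,3) ADER_I by blast
    show "ADER F (interchange_branches M L D)"
      using interchanged_has_type[OF bounds adm tails] D(1,3)
        ADER_I[OF set_interchange[OF set_D] reduced_interchange[OF D(3)]] by blast
  qed
qed

end
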